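(* Let $\rhd$ be a total order on disjoint sets that projects under $\rho$ to the total order $\prec$ on positive integers. Then for every set composition $\Phi$: (i) $P^{\prec}_\alpha=\sum_{\sigma\in\mathfrak{S}_\Phi}\rho\big(P^{\rhd}_{\sigma(\Phi)}\big)$, where $\alpha=\rho(\Phi)$; (ii) $\rho(P^{\rhd}_\Phi)=\sum_{\rho^{\rhd}_T(\Phi)\le\alpha\le\rho^{\rhd}_C(\Phi)}\mu_{\mathcal{P}}\big(\alpha,\rho^{\rhd}_C(\Phi)\big)F_\alpha$.
   Context: Compositions and $P^\prec$. A composition of $n$ is a sequence of positive integers with sum $n$, identified with a subset of $[n-1]$ by $(a_1,\dots,a_k)\leftrightarrow\{a_1,a_1+a_2,\dots,a_1+\cdots+a_{k-1}\}$; $\alpha\le\beta$ means $\beta$ is obtained from $\alpha$ by summing groups of consecutive parts (as subsets $\beta\subseteq\alpha$). $\mathcal{P}$ is the poset of compositions under $\le$ and $\mu_{\mathcal P}$ its Möbius function. $m_i(\alpha)$ is the number of parts equal to $i$. In $\mathrm{QSym}$ (over $\mathbb{Q}$): $M_\alpha=\sum_{i_1<\cdots<i_k}x_{i_1}^{a_1}\cdots x_{i_k}^{a_k}$, $F_\alpha=\sum_{\beta\le\alpha}M_\beta$. If $\alpha\le\beta=(b_1,\dots,b_l)$, write $\alpha$ as the concatenation $\alpha^{(1)}|\cdots|\alpha^{(l)}$ with $\alpha^{(j)}$ a composition of $b_j$; $c_i(\alpha,\beta)!=\prod_jm_i(\alpha^{(j)})!$, $C_{\alpha\beta}=\prod_i\frac{m_i(\alpha)!}{c_i(\alpha,\beta)!}$.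 For a total order $\prec$ on positive integers, $C^{\prec}(\alpha)$ is obtained from $\alpha$ by breaking it at every $i$ with $a_i\prec a_{i+1}$ and replacing each resulting run by its sum, and $P^{\prec}_\alpha=\sum_{\alpha\le\beta\le C^{\prec}(\alpha)}C_{\alpha\beta}M_\beta$. Set compositions and $P^\rhd$. A set composition of $[n]$ is an ordered list $\Phi=(B_1,\dots,B_k)$ of disjoint nonempty sets with union $[n]$; $\rho(\Phi)=(|B_1|,\dots,|B_k|)$. $\mathrm{NCQSym}$ has basis $(M_\Phi)$ and $\rho:\mathrm{NCQSym}\to\mathrm{QSym}$ is linear with $\rho(M_\Phi)=M_{\rho(\Phi)}$. A total order on disjoint sets is a relation $\rhd$ on nonempty finite sets of positive integers restricting to a strict total order on every family of pairwise disjoint sets; $\lhd$ is its reverse. It projects under $\rho$ to the total order on integers $\prec$ (with reverse relation $\succ$) if for all disjoint $A,B$ of different sizes, $B\rhd A$ implies $|B|\succ|A|$. $P^{\rhd}_\Phi=\sum_\Psi M_\Psi$, over all $\Psi$ obtained from $\Phi$ by choosing a subset $I$ of $\{i<k:B_i\rhd B_{i+1}\}$ and merging (by union) $B_i$ and $B_{i+1}$ into the same block for every $i\in I$. $\mathfrak{S}_\Phi$ is the group of permutations of the places of the blocks of $\Phi$ that only permute blocks of equal size among themselves; $\sigma(\Phi)$ is the resulting set composition. $\rho_C^\rhd,\rho_T^\rhd$. Break $\rho(\Phi)$ at every $i$ with $B_i\lhd B_{i+1}$ into $\beta_1|\cdots|\beta_l$. Then $\rho^{\rhd}_C(\Phi)=(|\beta_1|,\dots,|\beta_l|)$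 and $\rho^{\rhd}_T(\Phi)=\beta_1'|\cdots|\beta_l'$, where $\beta'$ is the transpose: the composition whose subset is the complement of that of $\beta$. Equivalently, as a subset of $[n-1]$, $\rho_T^{\rhd}(\Phi)$ is the complement of $\{|B_1|+\cdots+|B_i|:B_i\rhd B_{i+1}\}$. *)

theory Defs
  imports
    Complex_Main
    "HOL-Library.Disjoint_Sets"
    "HOL-Library.Function_Algebras"
    "HOL-Library.Poly_Mapping"
    "HOL-Combinatorics.Permutations"
    "HOL-Combinatorics.List_Permutation"
begin

section \<open>Compositions\<close>

definition composition :: "nat list \<Rightarrow> bool" where
  "composition \<alpha> \<longleftrightarrow> 0 \<notin> set \<alpha>"

definition comp_set :: "nat list \<Rightarrow> nat set" where
  "comp_set \<alpha> = {sum_list (take i \<alpha>) | i. 0 < i \<and> i < length \<alpha>}"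

definition grouping :: "nat list \<Rightarrow> nat list \<Rightarrow> nat list list \<Rightarrow> bool" where
  "grouping \<alpha> \<beta> \<gamma>s \<longleftrightarrow> [] \<notin> set \<gamma>s \<and> concat \<gamma>s = \<alpha> \<and> map sum_list \<gamma>s = \<beta>"

definition comp_le :: "nat list \<Rightarrow> nat list \<Rightarrow> bool"  (infix "\<preceq>\<^sub>P" 50) where
  "\<alpha> \<preceq>\<^sub>P \<beta> \<longleftrightarrow> composition \<alpha> \<and> (\<exists>\<gamma>s. grouping \<alpha> \<beta> \<gamma>s)"

text \<open>For \<open>\<alpha> \<preceq>\<^sub>P \<beta>\<close> the list \<open>\<alpha>\<^sup>(\<^sup>1\<^sup>), \<dots>, \<alpha>\<^sup>(\<^sup>l\<^sup>)\<close>; it is unique because all parts are positive.\<close>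

definition pieces :: "nat list \<Rightarrow> nat list \<Rightarrow> nat list list" where
  "pieces \<alpha> \<beta> = (THE \<gamma>s. grouping \<alpha> \<beta> \<gamma>s)"

lemma length_concat_ge: "[] \<notin> set \<gamma>s \<Longrightarrow> length \<gamma>s \<le> length (concat \<gamma>s)"
proof (induction \<gamma>s)
  case (Cons \<gamma> \<gamma>s)
  then show ?case by (cases \<gamma>) auto
qed simp

lemma length_concat_eq:
  "[] \<notin> set \<gamma>s \<Longrightarrow> length \<gamma>s = length (concat \<gamma>s) \<Longrightarrow> map sum_list \<gamma>s = (concat \<gamma>s :: nat list)"
proof (induction \<gamma>s)
  case (Cons \<gamma> \<gamma>s)
  have "length \<gamma>s \<le> length (concat \<gamma>s)" using Cons.prems by (intro length_concat_ge) auto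
  moreover have "\<gamma> \<noteq> []" using Cons.prems by auto
  ultimately have "length \<gamma> = 1" "length \<gamma>s = length (concat \<gamma>s)"
    using Cons.prems(2) by (cases \<gamma>; simp)+
  with Cons show ?case by (auto simp: length_Suc_conv)
qed simp

lemma comp_le_length:
  assumes "\<alpha> \<preceq>\<^sub>P \<beta>"
  shows "length \<beta> \<le> length \<alpha>"
proof -
  obtain \<gamma>s where "grouping \<alpha> \<beta> \<gamma>s" using assms unfolding comp_le_def by blast
  then show ?thesis using length_concat_ge[of \<gamma>s] unfolding grouping_def by auto
qed

lemma comp_le_length_less:
  assumes "\<alpha> \<preceq>\<^sub>P \<beta>" "\<alpha> \<noteq> \<beta>"
  shows "length \<beta> < length \<alpha>"
proof -
  obtain \<gamma>s where \<gamma>s: "grouping \<alpha> \<beta> \<gamma>s" using assms unfolding comp_le_def by blast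
  then have "length \<gamma>s \<noteq> length (concat \<gamma>s)"
    using assms(2) length_concat_eq[of \<gamma>s] unfolding grouping_def by metis
  then show ?thesis using \<gamma>s length_concat_ge[of \<gamma>s] unfolding grouping_def by auto
qed

lemma comp_le_sum_list:
  assumes "\<alpha> \<preceq>\<^sub>P \<beta>"
  shows "sum_list \<beta> = sum_list \<alpha>"
proof -
  obtain \<gamma>s where "grouping \<alpha> \<beta> \<gamma>s" using assms unfolding comp_le_def by blast
  moreover have "sum_list (map sum_list \<gamma>s) = sum_list (concat \<gamma>s)" by (induction \<gamma>s) auto
  ultimately show ?thesis unfolding grouping_def by auto
qed

lemma comp_le_composition:
  assumes "\<alpha> \<preceq>\<^sub>P \<beta>"
  shows "composition \<alpha> \<and> composition \<beta>"
proof -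
  obtain \<gamma>s where \<gamma>s: "[] \<notin> set \<gamma>s" "concat \<gamma>s = \<alpha>" "map sum_list \<gamma>s = \<beta>"
    using assms unfolding comp_le_def grouping_def by blast
  have \<alpha>: "composition \<alpha>" using assms unfolding comp_le_def by blast
  have "sum_list \<gamma> \<noteq> 0" if "\<gamma> \<in> set \<gamma>s" for \<gamma>
  proof -
    have "set \<gamma> \<subseteq> set \<alpha>" "\<gamma> \<noteq> []" using that \<gamma>s by auto
    then have "hd \<gamma> \<in> set \<gamma>" "hd \<gamma> \<in> set \<alpha>" by auto
    then have "hd \<gamma> \<in> set \<gamma>" "hd \<gamma> \<noteq> 0" using \<alpha> unfolding composition_def by metis+
    then show ?thesis using member_le_sum_list[of "hd \<gamma>" \<gamma>] by linarith
  qed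
  then have "0 \<notin> set \<beta>" unfolding \<gamma>s(3)[symmetric] by (metis in_set_conv_nth length_map nth_map nth_mem)
  then show ?thesis using \<alpha> unfolding composition_def by blast
qed

lemma composition_length: "composition \<alpha> \<Longrightarrow> length \<alpha> \<le> sum_list \<alpha>"
  by (induction \<alpha>) (auto simp: composition_def)

lemma finite_compositions: "finite {\<alpha>. composition \<alpha> \<and> sum_list \<alpha> = n}"
proof (rule finite_subset)
  show "{\<alpha>. composition \<alpha> \<and> sum_list \<alpha> = n} \<subseteq> {xs. set xs \<subseteq> {..n} \<and> length xs \<le> n}"
    using composition_length member_le_sum_list by blast
  show "finite {xs. set xs \<subseteq> {..n} \<and> length xs \<le> n}"
    by (rule finite_lists_length_le) simp
qed

lemma finite_comp_ge: "finite {\<beta>. \<alpha> \<preceq>\<^sub>P \<beta>}"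
proof (rule finite_subset)
  show "{\<beta>. \<alpha> \<preceq>\<^sub>P \<beta>} \<subseteq> {\<beta>. composition \<beta> \<and> sum_list \<beta> = sum_list \<alpha>}"
    using comp_le_sum_list comp_le_composition by blast
qed (rule finite_compositions)

lemma finite_comp_le: "finite {\<beta>. \<beta> \<preceq>\<^sub>P \<alpha>}"
proof (rule finite_subset)
  show "{\<beta>. \<beta> \<preceq>\<^sub>P \<alpha>} \<subseteq> {\<beta>. composition \<beta> \<and> sum_list \<beta> = sum_list \<alpha>}"
    using comp_le_sum_list comp_le_composition by fastforce
qed (rule finite_compositions)

function comp_mobius :: "nat list \<Rightarrow> nat list \<Rightarrow> int" where
  "comp_mobius \<alpha> \<beta> =
     (if \<alpha> \<preceq>\<^sub>P \<beta> then
        if \<alpha> = \<beta> then 1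
        else - (\<Sum>\<gamma>\<in>{\<gamma>. \<alpha> \<preceq>\<^sub>P \<gamma> \<and> \<gamma> \<preceq>\<^sub>P \<beta> \<and> \<gamma> \<noteq> \<beta>}. comp_mobius \<alpha> \<gamma>)
      else 0)"
  by auto
termination
proof (relation "measure (\<lambda>(\<alpha>, \<beta>). length \<alpha> - length \<beta>)", goal_cases)
  case (2 \<alpha> \<beta> \<gamma>)
  then show ?case using comp_le_length[of \<alpha> \<gamma>] comp_le_length_less[of \<gamma> \<beta>] by auto
qed simp

declare comp_mobius.simps [simp del]

definition transpose_comp :: "nat list \<Rightarrow> nat list" where
  "transpose_comp \<beta> = (THE \<gamma>. composition \<gamma> \<and> sum_list \<gamma> = sum_list \<beta> \<and>
     comp_set \<gamma> = {1..<sum_list \<beta>} - comp_set \<beta>)"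

text \<open>\<open>break_at R xs\<close> cuts \<open>xs\<close> between any adjacent \<open>x\<close>, \<open>y\<close> with \<open>R x y\<close>.\<close>

fun break_at :: "('a \<Rightarrow> 'a \<Rightarrow> bool) \<Rightarrow> 'a list \<Rightarrow> 'a list list" where
  "break_at R [] = []"
| "break_at R [x] = [[x]]"
| "break_at R (x # y # zs) =
     (if R x y then [x] # break_at R (y # zs)
      else (x # hd (break_at R (y # zs))) # tl (break_at R (y # zs)))"

definition comp_C :: "(nat \<Rightarrow> nat \<Rightarrow> bool) \<Rightarrow> nat list \<Rightarrow> nat list" where
  "comp_C prec \<alpha> = map sum_list (break_at prec \<alpha>)"

text \<open>Only \<open>i \<in> set \<alpha>\<close> contributes: for every other \<open>i\<close> all factorials are \<open>0! = 1\<close>.\<close>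

definition coeff_C :: "nat list \<Rightarrow> nat list \<Rightarrow> rat" where
  "coeff_C \<alpha> \<beta> = (\<Prod>i\<in>set \<alpha>.
     fact (count_list \<alpha> i) / (\<Prod>\<gamma>\<leftarrow>pieces \<alpha> \<beta>. fact (count_list \<gamma> i)))"


section \<open>Quasisymmetric functions\<close>

text \<open>
  A formal power series over the rationals in variables \<open>x\<^sub>0, x\<^sub>1, \<dots>\<close> is given by its
  coefficients; a monomial is the finitely supported function of its exponents.
  Sums are pointwise.
\<close>

type_synonym power_series = "(nat \<Rightarrow>\<^sub>0 nat) \<Rightarrow> rat"

definition ps_scale :: "rat \<Rightarrow> power_series \<Rightarrow> power_series"  (infixr "*\<^sub>Q" 75) where
  "c *\<^sub>Q f = (\<lambda>m. c * f m)"

text \<open>The coefficient of \<open>m\<close> counts the \<open>i\<^sub>1 < \<dots> < i\<^sub>k\<close> with \<open>x\<^sub>i\<^sub>1^a\<^sub>1 \<cdots> x\<^sub>i\<^sub>k^a\<^sub>k = m\<close>.\<close>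

definition M_qsym :: "nat list \<Rightarrow> power_series" where
  "M_qsym \<alpha> m = of_nat (card {is. length is = length \<alpha> \<and> sorted_wrt (<) is \<and>
     (\<Sum>j<length \<alpha>. Poly_Mapping.single (is ! j) (\<alpha> ! j)) = m})"

definition F_qsym :: "nat list \<Rightarrow> power_series" where
  "F_qsym \<alpha> = (\<Sum>\<beta> | \<beta> \<preceq>\<^sub>P \<alpha>. M_qsym \<beta>)"

definition P_qsym :: "(nat \<Rightarrow> nat \<Rightarrow> bool) \<Rightarrow> nat list \<Rightarrow> power_series" where
  "P_qsym prec \<alpha> =
     (\<Sum>\<beta> | \<alpha> \<preceq>\<^sub>P \<beta> \<and> \<beta> \<preceq>\<^sub>P comp_C prec \<alpha>. coeff_C \<alpha> \<beta> *\<^sub>Q M_qsym \<beta>)"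


section \<open>Set compositions\<close>

definition set_composition :: "nat \<Rightarrow> nat set list \<Rightarrow> bool" where
  "set_composition n \<Phi> \<longleftrightarrow> distinct \<Phi> \<and> partition_on {1..n} (set \<Phi>)"

definition block_sizes :: "nat set list \<Rightarrow> nat list" where
  "block_sizes \<Phi> = map card \<Phi>"

text \<open>
  NCQSym is the rational vector space with basis \<open>M\<^sub>\<Phi>\<close>: finitely supported coefficient
  functions on set compositions. The type also admits lists that are not set compositions
  as indices, but the elements used below never have them in their support.
\<close>

type_synonym ncqsym = "nat set list \<Rightarrow>\<^sub>0 rat"

definition M_nc :: "nat set list \<Rightarrow> ncqsym" where
  "M_nc \<Phi> = Poly_Mapping.single \<Phi> 1"

definition rho :: "ncqsym \<Rightarrow> power_series" where
  "rho f = (\<Sum>\<Phi>\<in>Poly_Mapping.keys f. Poly_Mapping.lookup f \<Phi> *\<^sub>Q M_qsym (block_sizes \<Phi>))"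

lemma ps_scale_simps:
  "(a + b) *\<^sub>Q f = a *\<^sub>Q f + b *\<^sub>Q f"
  "c *\<^sub>Q (f + g) = c *\<^sub>Q f + c *\<^sub>Q g"
  "a *\<^sub>Q b *\<^sub>Q f = (a * b) *\<^sub>Q f"
  "0 *\<^sub>Q f = 0" "c *\<^sub>Q 0 = 0" "1 *\<^sub>Q f = f"
  by (auto simp: ps_scale_def fun_eq_iff algebra_simps)

lemma ps_scale_sum: "c *\<^sub>Q sum g A = (\<Sum>x\<in>A. c *\<^sub>Q g x)"
  by (induction A rule: infinite_finite_induct) (simp_all only: ps_scale_simps sum.infinite sum.empty sum.insert not_False_eq_True)

lemma rho_M_nc: "rho (M_nc \<Phi>) = M_qsym (block_sizes \<Phi>)"
  by (simp add: rho_def M_nc_def ps_scale_simps)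

lemma rho_superset:
  assumes "finite A" "Poly_Mapping.keys f \<subseteq> A"
  shows "rho f = (\<Sum>\<Phi>\<in>A. Poly_Mapping.lookup f \<Phi> *\<^sub>Q M_qsym (block_sizes \<Phi>))"
  unfolding rho_def using assms
  by (intro sum.mono_neutral_left) (auto simp: in_keys_iff ps_scale_simps)

lemma rho_add: "rho (f + g) = rho f + rho g"
proof -
  let ?A = "Poly_Mapping.keys f \<union> Poly_Mapping.keys g"
  have A: "finite ?A" by simp
  have "rho (f + g) = (\<Sum>\<Phi>\<in>?A. Poly_Mapping.lookup (f + g) \<Phi> *\<^sub>Q M_qsym (block_sizes \<Phi>))"
    by (rule rho_superset[OF A Poly_Mapping.keys_add])
  also have "\<dots> = (\<Sum>\<Phi>\<in>?A. Poly_Mapping.lookup f \<Phi> *\<^sub>Q M_qsym (block_sizes \<Phi>))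
      + (\<Sum>\<Phi>\<in>?A. Poly_Mapping.lookup g \<Phi> *\<^sub>Q M_qsym (block_sizes \<Phi>))"
    by (simp only: lookup_add ps_scale_simps sum.distrib)
  also have "\<dots> = rho f + rho g"
    using rho_superset[OF A, of f] rho_superset[OF A, of g] by simp
  finally show ?thesis .
qed

lemma rho_scale: "rho (Poly_Mapping.map ((*) c) f) = c *\<^sub>Q rho f"
proof -
  have lookup: "Poly_Mapping.lookup (Poly_Mapping.map ((*) c) f) \<Phi> = c * Poly_Mapping.lookup f \<Phi>" for \<Phi>
    by (simp add: Poly_Mapping.map.rep_eq when_def)
  have "Poly_Mapping.keys (Poly_Mapping.map ((*) c) f) \<subseteq> Poly_Mapping.keys f"
    by (auto simp: in_keys_iff lookup)
  then have "rho (Poly_Mapping.map ((*) c) f) =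
      (\<Sum>\<Phi>\<in>Poly_Mapping.keys f. (c * Poly_Mapping.lookup f \<Phi>) *\<^sub>Q M_qsym (block_sizes \<Phi>))"
    using rho_superset[of "Poly_Mapping.keys f"] by (simp only: lookup finite_keys)
  then show ?thesis by (simp only: rho_def ps_scale_sum ps_scale_simps)
qed

text \<open>
  \<open>merge_at I [B\<^sub>0, \<dots>, B\<^sub>k]\<close> puts \<open>B\<^sub>i\<close> and \<open>B\<^sub>i\<^sub>+\<^sub>1\<close> into one block for every \<open>i \<in> I\<close>;
  places are counted from \<open>0\<close>.
\<close>

function merge_at :: "nat set \<Rightarrow> nat set list \<Rightarrow> nat set list" where
  "merge_at I [] = []"
| "merge_at I [B] = [B]"
| "merge_at I (B # B' # Bs) =
     (if 0 \<in> I then merge_at {i. Suc i \<in> I} ((B \<union> B') # Bs)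
      else B # merge_at {i. Suc i \<in> I} (B' # Bs))"
  by pat_completeness auto
termination by (relation "measure (length \<circ> snd)") auto

text \<open>\<open>tri A B\<close> stands for \<open>A \<rhd> B\<close>.\<close>

definition merges :: "(nat set \<Rightarrow> nat set \<Rightarrow> bool) \<Rightarrow> nat set list \<Rightarrow> nat set list set" where
  "merges tri \<Phi> =
     {merge_at I \<Phi> | I. I \<subseteq> {i. Suc i < length \<Phi> \<and> tri (\<Phi> ! i) (\<Phi> ! Suc i)}}"

definition P_nc :: "(nat set \<Rightarrow> nat set \<Rightarrow> bool) \<Rightarrow> nat set list \<Rightarrow> ncqsym" where
  "P_nc tri \<Phi> = (\<Sum>\<Psi>\<in>merges tri \<Phi>. M_nc \<Psi>)"

lemma finite_merges: "finite (merges tri \<Phi>)"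
proof -
  have "merges tri \<Phi> =
      (\<lambda>I. merge_at I \<Phi>) ` Pow {i. Suc i < length \<Phi> \<and> tri (\<Phi> ! i) (\<Phi> ! Suc i)}"
    by (auto simp: merges_def)
  moreover have "finite {i. Suc i < length \<Phi> \<and> tri (\<Phi> ! i) (\<Phi> ! Suc i)}"
    by (rule finite_subset[of _ "{..<length \<Phi>}"]) auto
  ultimately show ?thesis by simp
qed

text \<open>
  A permutation \<open>\<sigma>\<close> acts on \<open>\<Phi>\<close> by \<open>permute_list \<sigma> \<Phi>\<close>, whose place \<open>i\<close> holds the block from
  place \<open>\<sigma> i\<close>. This is the action of the inverse in the convention moving the block at \<open>i\<close> to
  \<open>\<sigma> i\<close>; sums over the whole group do not depend on the choice.
\<close>

definition block_perms :: "nat set list \<Rightarrow> (nat \<Rightarrow> nat) set" where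
  "block_perms \<Phi> = {\<sigma>. \<sigma> permutes {..<length \<Phi>} \<and>
     (\<forall>i<length \<Phi>. card (\<Phi> ! \<sigma> i) = card (\<Phi> ! i))}"

definition rho_C :: "(nat set \<Rightarrow> nat set \<Rightarrow> bool) \<Rightarrow> nat set list \<Rightarrow> nat list" where
  "rho_C tri \<Phi> = map (\<lambda>\<Theta>. sum_list (block_sizes \<Theta>)) (break_at (\<lambda>A B. tri B A) \<Phi>)"

definition rho_T :: "(nat set \<Rightarrow> nat set \<Rightarrow> bool) \<Rightarrow> nat set list \<Rightarrow> nat list" where
  "rho_T tri \<Phi> =
     concat (map (\<lambda>\<Theta>. transpose_comp (block_sizes \<Theta>)) (break_at (\<lambda>A B. tri B A) \<Phi>))"


section \<open>Orders on integers and on disjoint sets\<close>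

definition strict_total_order_on :: "'a set \<Rightarrow> ('a \<Rightarrow> 'a \<Rightarrow> bool) \<Rightarrow> bool" where
  "strict_total_order_on A R \<longleftrightarrow> irreflp_on A R \<and> transp_on A R \<and> totalp_on A R"

definition blocks :: "nat set set" where
  "blocks = {A. finite A \<and> A \<noteq> {} \<and> 0 \<notin> A}"

definition total_order_on_disjoint_sets :: "(nat set \<Rightarrow> nat set \<Rightarrow> bool) \<Rightarrow> bool" where
  "total_order_on_disjoint_sets tri \<longleftrightarrow>
     (\<forall>\<F> \<subseteq> blocks. disjoint \<F> \<longrightarrow> strict_total_order_on \<F> tri)"

definition projects_to ::
    "(nat set \<Rightarrow> nat set \<Rightarrow> bool) \<Rightarrow> (nat \<Rightarrow> nat \<Rightarrow> bool) \<Rightarrow> bool" where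
  "projects_to tri prec \<longleftrightarrow>
     (\<forall>A\<in>blocks. \<forall>B\<in>blocks. A \<inter> B = {} \<and> card A \<noteq> card B \<and> tri B A \<longrightarrow> prec (card A) (card B))"

end

theory Submission
  imports Defs
begin

text \<open>
  A composition is encoded by its set of prefix sums, its total included; then \<open>\<preceq>\<^sub>P\<close> becomes reverse
  inclusion, every interval is Boolean, and the Moebius function is a sign. Merging the blocks at \<open>I\<close>
  deletes the prefix sums indexed by \<open>I\<close>, so that \<open>\<rho>(P\<^sub>\<Phi>)\<close> is the sum of \<open>M\<^sub>\<beta>\<close> over the interval from
  \<open>\<rho>(\<Phi>)\<close> to \<open>\<rho>\<^sub>C(\<Phi>)\<close>. Part (ii) follows by exchanging the two summations and cancelling alternating
  sums. In part (i) the coefficient of \<open>M\<^sub>\<beta>\<close> counts the \<open>\<sigma>\<close> that are decreasing with respect to \<open>\<rhd>\<close> on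
  each piece of \<open>\<beta>\<close>; as the order between blocks of different sizes is forced by \<open>\<prec>\<close>, these are
  coset representatives of the permutations preserving pieces and sizes, and there are \<open>C\<^sub>\<alpha>\<^sub>\<beta>\<close> of them.
\<close>


section \<open>Prefix sums and the order on compositions\<close>

text \<open>Including the total makes the encoding injective on all compositions at once, the empty
  one among them, and makes its cardinality the length, whose parity gives the sign. The obstacle in
  part (i) is that decrease along a piece also involves neighbours of different sizes, so it is not
  at first sight a condition on the orbits of a permutation group. If \<beta> lies below
  C^\<prec>(\<alpha>), no neighbours in a piece have sizes that ascend for \<prec>, so neighbours of
  different sizes are in the right order for every \<sigma>, and only blocks of equal size in one
  piece remain to be arranged. Otherwise some neighbours in a piece are in the wrong order for every
  \<sigma>. The count thus becomes the index of one Young subgroup in another. In part (ii) the set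
  of \<open>rho_T\<close> is a complement so that its join with \<beta> is \<open>rho_C\<close>
  exactly when \<beta> has no prefix sums outside those of \<rho>(\<Phi>).\<close>

definition psums :: "nat list \<Rightarrow> nat set" where
  "psums \<alpha> = {sum_list (take (Suc i) \<alpha>) | i. i < length \<alpha>}"

lemma psums_Nil [simp]: "psums [] = {}"
  by (simp add: psums_def)

lemma psums_Cons: "psums (a # \<alpha>) = insert a ((+) a ` psums \<alpha>)"
proof -
  have "psums (a # \<alpha>) = (\<lambda>i. sum_list (take (Suc i) (a # \<alpha>))) ` {..<Suc (length \<alpha>)}"
    by (auto simp: psums_def)
  also have "\<dots> = insert a ((\<lambda>i. a + sum_list (take (Suc i) \<alpha>)) ` {..<length \<alpha>})"
    by (simp add: lessThan_Suc_eq_insert_0 image_image)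
  also have "(\<lambda>i. a + sum_list (take (Suc i) \<alpha>)) ` {..<length \<alpha>} = (+) a ` psums \<alpha>"
    by (auto simp: psums_def)
  finally show ?thesis .
qed

lemma psums_append: "psums (\<alpha> @ \<beta>) = psums \<alpha> \<union> (+) (sum_list \<alpha>) ` psums \<beta>"
  by (induction \<alpha>) (auto simp: psums_Cons image_image image_Un add.assoc)

lemma finite_psums [simp]: "finite (psums \<alpha>)"
  by (induction \<alpha>) (auto simp: psums_Cons)

lemma psums_subset: "composition \<alpha> \<Longrightarrow> psums \<alpha> \<subseteq> {1..sum_list \<alpha>}"
  by (induction \<alpha>) (force simp: psums_Cons composition_def)+

lemma composition_Cons: "composition (a # \<alpha>) \<longleftrightarrow> 0 < a \<and> composition \<alpha>"
  by (auto simp: composition_def)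

lemma composition_Nil [simp]: "composition []"
  by (simp add: composition_def)

lemma composition_append: "composition (\<alpha> @ \<beta>) \<longleftrightarrow> composition \<alpha> \<and> composition \<beta>"
  by (auto simp: composition_def)

lemma sum_list_mem_psums: "\<alpha> \<noteq> [] \<Longrightarrow> sum_list \<alpha> \<in> psums \<alpha>"
  by (auto simp: psums_def intro!: exI[of _ "length \<alpha> - 1"])

lemma comp_set_eq_psums: "composition \<alpha> \<Longrightarrow> comp_set \<alpha> = psums \<alpha> - {sum_list \<alpha>}"
proof (cases "\<alpha> = []")
  case False
  assume \<alpha>: "composition \<alpha>"
  \<comment> \<open>A proper prefix leaves parts of positive sum, so the total is attained only at
    the last index; deleting it from \<open>psums\<close> deletes that index alone.\<close>
  have less: "sum_list (take i \<alpha>) < sum_list \<alpha>" if "i < length \<alpha>" for i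
  proof -
    have "composition (take i \<alpha> @ drop i \<alpha>)" using \<alpha> by simp
    then have "composition (drop i \<alpha>)" unfolding composition_append by simp
    moreover have "drop i \<alpha> \<noteq> []" using that by simp
    ultimately have "0 < sum_list (drop i \<alpha>)"
      using sum_list_mem_psums[of "drop i \<alpha>"] psums_subset[of "drop i \<alpha>"] by fastforce
    moreover have "sum_list \<alpha> = sum_list (take i \<alpha>) + sum_list (drop i \<alpha>)"
      by (metis append_take_drop_id sum_list_append)
    ultimately show ?thesis by simp
  qed
  show ?thesis
  proof (intro set_eqI iffI)
    fix x assume "x \<in> comp_set \<alpha>"
    then obtain i where i: "0 < i" "i < length \<alpha>" "x = sum_list (take i \<alpha>)"
      by (auto simp: comp_set_def)
    then have "x \<in> psums \<alpha>" unfolding psums_def by (intro CollectI exI[of _ "i - 1"]) auto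
    then show "x \<in> psums \<alpha> - {sum_list \<alpha>}" using less[OF i(2)] i(3) by auto
  next
    fix x assume x: "x \<in> psums \<alpha> - {sum_list \<alpha>}"
    then obtain i where "i < length \<alpha>" "x = sum_list (take (Suc i) \<alpha>)"
      by (auto simp: psums_def)
    moreover from this x have "Suc i \<noteq> length \<alpha>" by auto
    ultimately show "x \<in> comp_set \<alpha>" unfolding comp_set_def by (intro CollectI exI[of _ "Suc i"]) auto
  qed
qed (simp add: comp_set_def)

lemma card_psums: "composition \<alpha> \<Longrightarrow> card (psums \<alpha>) = length \<alpha>"
proof (induction \<alpha>)
  case (Cons a \<alpha>)
  have "a \<notin> (+) a ` psums \<alpha>" using psums_subset[of \<alpha>] Cons.prems by (auto simp: composition_Cons)
  then show ?case using Cons by (simp add: psums_Cons composition_Cons card_image)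
qed simp

text \<open>The first part is the least prefix sum, and enlarging a set cannot raise its minimum.
  Used in both directions, this recovers the first part from the set.\<close>

lemma psums_Cons_inj:
  assumes "composition (a # \<alpha>)" "composition (b # \<beta>)" "psums (a # \<alpha>) \<subseteq> psums (b # \<beta>)"
  shows "b \<le> a"
  using assms by (auto simp: psums_Cons)

text \<open>Once the least element is removed, all others exceed \<open>a\<close>, so the truncated
  subtraction is a genuine shift.\<close>

lemma psums_tail_diff:
  "composition (a # \<alpha>) \<Longrightarrow> psums \<alpha> = (\<lambda>x. x - a) ` (psums (a # \<alpha>) - {a})"
  using psums_subset[of \<alpha>] by (force simp: psums_Cons composition_Cons)

lemma psums_inject:
  assumes "composition \<alpha>" "composition \<beta>" "psums \<alpha> = psums \<beta>"
  shows "\<alpha> = \<beta>"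
  using assms
proof (induction \<alpha> arbitrary: \<beta>)
  case Nil
  then show ?case by (cases \<beta>) (auto simp: psums_Cons)
next
  case (Cons a \<alpha>)
  then obtain b \<beta>' where \<beta>: "\<beta> = b # \<beta>'" by (cases \<beta>) (auto simp: psums_Cons)
  with Cons.prems have "a = b" using psums_Cons_inj[of a \<alpha> b \<beta>'] psums_Cons_inj[of b \<beta>' a \<alpha>] by auto
  moreover from this have "psums \<alpha> = psums \<beta>'"
    using psums_tail_diff[OF Cons.prems(1)] psums_tail_diff[of b \<beta>'] Cons.prems \<beta> by simp
  ultimately show ?case using Cons \<beta> by (auto simp: composition_Cons)
qed

text \<open>Insertion in increasing order appends one part for each element: the gap to the previous
  maximum, or to 0 at the start.\<close>

lemma psums_surj:
  assumes "finite S" "0 \<notin> S"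
  obtains \<alpha> where "composition \<alpha>" "psums \<alpha> = S"
  using assms
proof (induction S arbitrary: thesis rule: finite_linorder_max_induct)
  case (insert b S)
  obtain \<alpha> where \<alpha>: "composition \<alpha>" "psums \<alpha> = S" using insert.IH insert.prems(2) by blast
  have "sum_list \<alpha> < b"
    using sum_list_mem_psums[of \<alpha>] \<alpha> insert.hyps(2) insert.prems(2) by (cases "\<alpha> = []") auto
  then have "composition (\<alpha> @ [b - sum_list \<alpha>]) \<and> psums (\<alpha> @ [b - sum_list \<alpha>]) = insert b S"
    using \<alpha> by (simp add: composition_append composition_Cons psums_append psums_Cons)
  then show ?case using insert.prems(1) by blast
next
  case empty
  then show ?case using composition_Nil psums_Nil by blast
qed

lemma sum_list_mono_psums:
  assumes "composition \<beta>" "psums \<alpha> \<subseteq> psums \<beta>"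
  shows "sum_list \<alpha> \<le> sum_list \<beta>"
proof (cases "\<alpha> = []")
  case False
  then have "sum_list \<alpha> \<in> psums \<beta>" using sum_list_mem_psums assms(2) by blast
  then show ?thesis using psums_subset[OF assms(1)] by auto
qed simp

lemma psums_map_sum_list_subset: "[] \<notin> set \<gamma>s \<Longrightarrow> psums (map sum_list \<gamma>s) \<subseteq> psums (concat \<gamma>s)"
  by (induction \<gamma>s) (auto simp: psums_Cons psums_append sum_list_mem_psums)

text \<open>The first part of \<beta> is a prefix sum of \<alpha>, which fixes where the first group
  ends; the rest of \<alpha> satisfies the hypotheses for the rest of \<beta>.\<close>

lemma ex_grouping:
  assumes "composition \<alpha>" "composition \<beta>" "psums \<beta> \<subseteq> psums \<alpha>" "sum_list \<alpha> = sum_list \<beta>"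
  shows "\<exists>\<gamma>s. grouping \<alpha> \<beta> \<gamma>s"
  using assms
proof (induction \<beta> arbitrary: \<alpha>)
  case Nil
  then have "\<alpha> = []" using sum_list_mem_psums[of \<alpha>] psums_subset[of \<alpha>] by fastforce
  then show ?case by (auto simp: grouping_def)
next
  case (Cons b \<beta>)
  then obtain i where i: "i < length \<alpha>" "b = sum_list (take (Suc i) \<alpha>)"
    by (auto simp: psums_Cons psums_def)
  define \<gamma> \<delta> where "\<gamma> = take (Suc i) \<alpha>" and "\<delta> = drop (Suc i) \<alpha>"
  have \<alpha>: "\<alpha> = \<gamma> @ \<delta>" and \<gamma>: "\<gamma> \<noteq> []" "sum_list \<gamma> = b"
    using i by (auto simp: \<gamma>_def \<delta>_def)
  have comp: "composition \<gamma>" "composition \<delta>" "composition \<beta>"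
    using Cons.prems by (auto simp: \<alpha> composition_append composition_Cons)
  have "psums \<beta> \<subseteq> psums \<delta>"
  proof
    fix x assume x: "x \<in> psums \<beta>"
    then have "b + x \<in> psums \<gamma> \<union> (+) b ` psums \<delta>"
      using Cons.prems(3) by (auto simp: psums_Cons \<alpha> psums_append \<gamma>)
    moreover have "b + x \<notin> psums \<gamma>"
      using psums_subset[OF comp(1)] psums_subset[OF comp(3)] x \<gamma> by fastforce
    ultimately show "x \<in> psums \<delta>" by auto
  qed
  then obtain \<gamma>s where "grouping \<delta> \<beta> \<gamma>s"
    using Cons.IH[of \<delta>] comp Cons.prems(4) \<alpha> \<gamma> by auto
  then have "grouping \<alpha> (b # \<beta>) (\<gamma> # \<gamma>s)" using \<gamma> \<alpha> by (auto simp: grouping_def)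
  then show ?case by blast
qed

text \<open>The sums are compared separately: a subset of the prefix sums may miss the total, as {1}
  inside {1, 2}, and then comes from a composition of a smaller number.\<close>

lemma comp_le_iff:
  "\<alpha> \<preceq>\<^sub>P \<beta> \<longleftrightarrow> composition \<alpha> \<and> composition \<beta> \<and> psums \<beta> \<subseteq> psums \<alpha> \<and> sum_list \<alpha> = sum_list \<beta>"
proof
  assume le: "\<alpha> \<preceq>\<^sub>P \<beta>"
  then obtain \<gamma>s where "grouping \<alpha> \<beta> \<gamma>s" by (auto simp: comp_le_def)
  then have "psums \<beta> \<subseteq> psums \<alpha>" using psums_map_sum_list_subset by (auto simp: grouping_def)
  then show "composition \<alpha> \<and> composition \<beta> \<and> psums \<beta> \<subseteq> psums \<alpha> \<and> sum_list \<alpha> = sum_list \<beta>"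
    using le comp_le_composition comp_le_sum_list by force
qed (auto simp: comp_le_def ex_grouping)

lemma comp_le_trans: "\<alpha> \<preceq>\<^sub>P \<beta> \<Longrightarrow> \<beta> \<preceq>\<^sub>P \<gamma> \<Longrightarrow> \<alpha> \<preceq>\<^sub>P \<gamma>"
  by (auto simp: comp_le_iff)

text \<open>Of two initial groups with equal sums one is a prefix of the other, and the surplus is a
  composition of 0, hence empty. This gives the definite description in \<open>pieces\<close> its
  value.\<close>

lemma grouping_unique:
  assumes "composition \<alpha>" "grouping \<alpha> \<beta> \<gamma>s" "grouping \<alpha> \<beta> \<delta>s"
  shows "\<gamma>s = \<delta>s"
  using assms
proof (induction \<gamma>s arbitrary: \<alpha> \<beta> \<delta>s)
  case Nil
  then show ?case by (auto simp: grouping_def)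
next
  case (Cons \<gamma> \<gamma>s)
  then obtain \<delta> \<delta>s' where \<delta>s: "\<delta>s = \<delta> # \<delta>s'" by (cases \<delta>s) (auto simp: grouping_def)
  have eq: "\<gamma> @ concat \<gamma>s = \<delta> @ concat \<delta>s'" "sum_list \<gamma> = sum_list \<delta>"
    using Cons.prems \<delta>s by (auto simp: grouping_def)
  have "composition (\<gamma> @ concat \<gamma>s)" "composition (\<delta> @ concat \<delta>s')"
    using Cons.prems \<delta>s by (simp_all add: grouping_def)
  then have comp: "composition \<gamma>" "composition \<delta>" "composition (concat \<gamma>s)" "composition (concat \<delta>s')"
    by (simp_all only: composition_append)
  have pos: "\<xi> = []" if "composition \<xi>" "sum_list \<xi> = 0" for \<xi>
    using that sum_list_mem_psums[of \<xi>] psums_subset[of \<xi>] by fastforce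
  from eq(1) have "\<gamma> = \<delta>"
    using comp eq(2) pos by (auto simp: append_eq_append_conv2 composition_append)
  moreover from this have "\<gamma>s = \<delta>s'"
    using Cons.IH[of "concat \<gamma>s" "map sum_list \<gamma>s" \<delta>s'] Cons.prems eq comp \<delta>s
    by (auto simp: grouping_def)
  ultimately show ?case using \<delta>s by simp
qed

lemma pieces_eq: "composition \<alpha> \<Longrightarrow> grouping \<alpha> \<beta> \<gamma>s \<Longrightarrow> pieces \<alpha> \<beta> = \<gamma>s"
  unfolding pieces_def using grouping_unique by blast

section \<open>Alternating sums over Boolean intervals and the Moebius function\<close>

lemma sum_alternating_Pow:
  "finite A \<Longrightarrow> (\<Sum>X\<in>Pow A. (-1) ^ card X :: int) = (if A = {} then 1 else 0)"
proof (induction A rule: finite_induct)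
  case (insert a A)
  have "(\<Sum>X\<in>Pow (insert a A). (-1) ^ card X :: int)
      = (\<Sum>X\<in>Pow A. (-1) ^ card X) + (\<Sum>X\<in>insert a ` Pow A. (-1) ^ card X)"
    unfolding Pow_insert using insert.hyps by (intro sum.union_disjoint) auto
  also have "(\<Sum>X\<in>insert a ` Pow A. (-1) ^ card X :: int) = (\<Sum>X\<in>Pow A. (-1) ^ card (insert a X))"
    using insert.hyps by (intro sum.reindex_cong[of "insert a"]) (auto simp: inj_on_def)
  also have "\<dots> = (\<Sum>X\<in>Pow A. - ((-1) ^ card X))"
  proof (intro sum.cong refl)
    fix X assume "X \<in> Pow A"
    then have "finite X" "a \<notin> X" using insert.hyps finite_subset by auto
    then show "(-1) ^ card (insert a X) = - ((-1) ^ card X :: int)" by simp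
  qed
  finally show ?case by (simp add: sum_negf)
qed simp

lemma sum_alternating_interval:
  assumes "finite Y" "X \<subseteq> Y"
  shows "(\<Sum>A | X \<subseteq> A \<and> A \<subseteq> Y. (-1) ^ card A :: int) = (if X = Y then (-1) ^ card X else 0)"
proof -
  have fin: "finite X" using assms finite_subset by blast
  have "(\<Sum>A | X \<subseteq> A \<and> A \<subseteq> Y. (-1) ^ card A :: int) = (\<Sum>Z\<in>Pow (Y - X). (-1) ^ (card X + card Z))"
  proof (rule sum.reindex_bij_witness[of _ "\<lambda>Z. X \<union> Z" "\<lambda>A. A - X"])
    fix A assume A: "A \<in> {A. X \<subseteq> A \<and> A \<subseteq> Y}"
    then have "card A = card X + card (A - X)"
      using fin by (metis (no_types, lifting) assms(1) card_Diff_subset card_mono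
          le_add_diff_inverse mem_Collect_eq rev_finite_subset)
    then show "(-1) ^ (card X + card (A - X)) = (-1 :: int) ^ card A" by simp
  qed (use assms(2) in auto)
  also have "\<dots> = (-1) ^ card X * (\<Sum>Z\<in>Pow (Y - X). (-1) ^ card Z)"
    by (simp add: power_add sum_distrib_left)
  also have "\<dots> = (if X = Y then (-1) ^ card X else 0)"
    using assms by (subst sum_alternating_Pow) auto
  finally show ?thesis .
qed

text \<open>Larger sets correspond to finer compositions, so the ends of the interval change
  places.\<close>

lemma bij_betw_psums_interval:
  assumes "\<alpha> \<preceq>\<^sub>P \<beta>"
  shows "bij_betw psums {\<gamma>. \<alpha> \<preceq>\<^sub>P \<gamma> \<and> \<gamma> \<preceq>\<^sub>P \<beta>} {A. psums \<beta> \<subseteq> A \<and> A \<subseteq> psums \<alpha>}"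
  unfolding bij_betw_def
proof
  show "inj_on psums {\<gamma>. \<alpha> \<preceq>\<^sub>P \<gamma> \<and> \<gamma> \<preceq>\<^sub>P \<beta>}"
    by (auto simp: inj_on_def comp_le_iff psums_inject)
  show "psums ` {\<gamma>. \<alpha> \<preceq>\<^sub>P \<gamma> \<and> \<gamma> \<preceq>\<^sub>P \<beta>} = {A. psums \<beta> \<subseteq> A \<and> A \<subseteq> psums \<alpha>}" (is "?L = ?R")
  proof
    show "?R \<subseteq> ?L"
    proof
      fix A assume A: "A \<in> ?R"
      then have "finite A" "0 \<notin> A"
        using psums_subset[of \<alpha>] assms finite_subset[of A "psums \<alpha>"] by (auto simp: comp_le_iff)
      then obtain \<gamma> where \<gamma>: "composition \<gamma>" "psums \<gamma> = A" by (rule psums_surj)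
      \<comment> \<open>The total of \<gamma> is squeezed between two equal totals, so every
        intermediate set belongs to a composition of the same number.\<close>
      then have "sum_list \<gamma> \<le> sum_list \<alpha>" "sum_list \<beta> \<le> sum_list \<gamma>"
        using A assms sum_list_mono_psums[of \<alpha> \<gamma>] sum_list_mono_psums[of \<gamma> \<beta>]
        by (auto simp: comp_le_iff)
      then show "A \<in> ?L" using A \<gamma> assms by (intro image_eqI[of _ _ \<gamma>]) (auto simp: comp_le_iff)
    qed
  qed (auto simp: comp_le_iff)
qed

lemma sum_alternating_comp_interval:
  assumes "\<alpha> \<preceq>\<^sub>P \<beta>"
  shows "(\<Sum>\<gamma> | \<alpha> \<preceq>\<^sub>P \<gamma> \<and> \<gamma> \<preceq>\<^sub>P \<beta>. (-1) ^ length \<gamma> :: int) = (if \<alpha> = \<beta> then (-1) ^ length \<beta> else 0)"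
proof -
  have "(\<Sum>\<gamma> | \<alpha> \<preceq>\<^sub>P \<gamma> \<and> \<gamma> \<preceq>\<^sub>P \<beta>. (-1) ^ length \<gamma> :: int)
      = (\<Sum>\<gamma> | \<alpha> \<preceq>\<^sub>P \<gamma> \<and> \<gamma> \<preceq>\<^sub>P \<beta>. (-1) ^ card (psums \<gamma>))"
    by (intro sum.cong) (auto simp: card_psums comp_le_iff)
  also have "\<dots> = (\<Sum>A | psums \<beta> \<subseteq> A \<and> A \<subseteq> psums \<alpha>. (-1) ^ card A)"
    by (rule sum.reindex_bij_betw[OF bij_betw_psums_interval[OF assms]])
  also have "\<dots> = (if psums \<beta> = psums \<alpha> then (-1) ^ card (psums \<beta>) else 0)"
    using assms by (intro sum_alternating_interval) (auto simp: comp_le_iff)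
  finally show ?thesis using assms psums_inject by (auto simp: comp_le_iff card_psums)
qed

text \<open>The sum over the whole interval vanishes, so leaving out \<beta> leaves minus its term,
  which the recursion negates. Only the parity of the rank matters; adding the lengths avoids
  truncated subtraction.\<close>

lemma comp_mobius_eq:
  "\<alpha> \<preceq>\<^sub>P \<beta> \<Longrightarrow> comp_mobius \<alpha> \<beta> = (-1) ^ (length \<alpha> + length \<beta>)"
proof (induction \<alpha> \<beta> rule: comp_mobius.induct)
  case (1 \<alpha> \<beta>)
  note IH = 1(1) and le = 1(2)
  show ?case
  proof (cases "\<alpha> = \<beta>")
    case True
    then show ?thesis using le by (subst comp_mobius.simps) simp
  next
    case False
    let ?I = "{\<gamma>. \<alpha> \<preceq>\<^sub>P \<gamma> \<and> \<gamma> \<preceq>\<^sub>P \<beta>}"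
    have fin: "finite ?I" using finite_comp_ge[of \<alpha>] by (rule rev_finite_subset) auto
    have "\<beta> \<in> ?I" using le by (simp add: comp_le_iff)
    have "comp_mobius \<alpha> \<beta> = - (\<Sum>\<gamma>\<in>{\<gamma>. \<alpha> \<preceq>\<^sub>P \<gamma> \<and> \<gamma> \<preceq>\<^sub>P \<beta> \<and> \<gamma> \<noteq> \<beta>}. comp_mobius \<alpha> \<gamma>)"
      by (subst comp_mobius.simps) (simp only: le False if_True if_False)
    also have "\<dots> = - (\<Sum>\<gamma>\<in>?I - {\<beta>}. (-1) ^ length \<alpha> * (-1) ^ length \<gamma>)"
      using IH[OF le False] by (intro arg_cong[of _ _ uminus] sum.cong) (auto simp: power_add)
    also have "\<dots> = (-1) ^ length \<alpha> * ((-1) ^ length \<beta> - (\<Sum>\<gamma>\<in>?I. (-1) ^ length \<gamma>))"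
      using fin \<open>\<beta> \<in> ?I\<close> unfolding sum_distrib_left[symmetric]
      by (simp add: sum_diff1 right_diff_distrib)
    also have "(\<Sum>\<gamma>\<in>?I. (-1) ^ length \<gamma> :: int) = 0"
      using sum_alternating_comp_interval[OF le] False by simp
    finally show ?thesis by (simp add: power_add)
  qed
qed


section \<open>Merging, breaking and transposing\<close>

lemma psums_eq_image: "psums \<alpha> = (\<lambda>i. sum_list (take (Suc i) \<alpha>)) ` {..<length \<alpha>}"
  by (auto simp: psums_def)

text \<open>The image has as many elements as there are indices. This later recovers a set of merged
  places from the prefix sums that it deletes.\<close>

lemma inj_on_prefix_sums:
  "composition \<alpha> \<Longrightarrow> inj_on (\<lambda>i. sum_list (take (Suc i) \<alpha>)) {..<length \<alpha>}"
  by (rule eq_card_imp_inj_on) (simp_all add: card_psums psums_eq_image[symmetric])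

lemma block_sizes_simps [simp]:
  "block_sizes [] = []" "block_sizes (B # \<Phi>) = card B # block_sizes \<Phi>"
  "length (block_sizes \<Phi>) = length \<Phi>"
  by (simp_all add: block_sizes_def)

lemma composition_block_sizes:
  "\<forall>B\<in>set \<Phi>. finite B \<and> B \<noteq> {} \<Longrightarrow> composition (block_sizes \<Phi>)"
  by (auto simp: composition_def block_sizes_def)

lemma merge_at_nonempty:
  "\<forall>B\<in>set \<Phi>. finite B \<and> B \<noteq> {} \<Longrightarrow> \<forall>B\<in>set (merge_at I \<Phi>). finite B \<and> B \<noteq> {}"
  by (induction I \<Phi> rule: merge_at.induct) auto

text \<open>Sizes of disjoint blocks add, so uniting the first two deletes the single prefix sum
  \<open>card B\<close>. Disjointness is stated along the list because the list headed by the union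
  inherits it.\<close>

lemma psums_merge_at:
  assumes "sorted_wrt (\<lambda>A B. A \<inter> B = {}) \<Phi>" "\<forall>B\<in>set \<Phi>. finite B \<and> B \<noteq> {}"
    "I \<subseteq> {i. Suc i < length \<Phi>}"
  shows "psums (block_sizes (merge_at I \<Phi>)) =
    psums (block_sizes \<Phi>) - (\<lambda>i. sum_list (take (Suc i) (block_sizes \<Phi>))) ` I"
  using assms
proof (induction I \<Phi> rule: merge_at.induct)
  case (3 I B B' Bs)
  let ?J = "{i. Suc i \<in> I}"
  let ?s = "\<lambda>\<Phi> i. sum_list (take (Suc i) (block_sizes \<Phi>))"
  have J: "?J \<subseteq> {i. Suc i < length (B' # Bs)}" using 3(5) by auto
  \<comment> \<open>Every place but 0 is a successor; \<open>?J\<close> renumbers these places for a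
    list that is one shorter.\<close>
  have I: "I = (if 0 \<in> I then insert 0 (Suc ` ?J) else Suc ` ?J)"
    by (auto simp: image_iff) (metis not0_implies_Suc)+
  have pos: "0 \<notin> psums (block_sizes Bs)" "0 < card B'" "0 < card B"
    using psums_subset[OF composition_block_sizes[of Bs]] 3(4) by (auto simp: card_gt_0_iff)
  have shift: "?s (B # B' # Bs) ` Suc ` ?J = (+) (card B) ` ?s (B' # Bs) ` ?J"
    by (simp add: image_image)
  show ?case
  proof (cases "0 \<in> I")
    case True
    have cardU: "card (B \<union> B') = card B + card B'"
      using 3(3,4) by (intro card_Un_disjoint) auto
    have "psums (block_sizes (merge_at I (B # B' # Bs))) =
        psums (block_sizes ((B \<union> B') # Bs)) - ?s ((B \<union> B') # Bs) ` ?J"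
      using True 3 J by (auto simp: Int_Un_distrib2)
    \<comment> \<open>Place \<open>i\<close> after the union is place \<open>Suc i\<close> of the
      original list, just as it is after \<open>B\<close> is set aside.\<close>
    also have "?s ((B \<union> B') # Bs) ` ?J = (+) (card B) ` ?s (B' # Bs) ` ?J"
      by (simp add: image_image cardU add.assoc)
    also have "psums (block_sizes ((B \<union> B') # Bs)) = psums (block_sizes (B # B' # Bs)) - {card B}"
      using pos by (auto simp: psums_Cons cardU image_image add.assoc)
    also have "\<dots> - (+) (card B) ` ?s (B' # Bs) ` ?J = psums (block_sizes (B # B' # Bs)) - ?s (B # B' # Bs) ` I"
      using True by (subst (2) I) (simp only: if_True image_insert shift, auto)
    finally show ?thesis .
  next
    case False
    have "psums (block_sizes (merge_at I (B # B' # Bs))) =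
        insert (card B) ((+) (card B) ` (psums (block_sizes (B' # Bs)) - ?s (B' # Bs) ` ?J))"
      using False 3 J by (auto simp: psums_Cons)
    also have "\<dots> = insert (card B) ((+) (card B) ` psums (block_sizes (B' # Bs)) - ?s (B # B' # Bs) ` Suc ` ?J)"
      unfolding shift by (subst image_set_diff) auto
    also have "\<dots> = psums (block_sizes (B # B' # Bs)) - ?s (B # B' # Bs) ` Suc ` ?J"
      using pos by (auto simp: psums_Cons)
    finally show ?thesis using False by (subst (2) I) simp
  qed
qed (auto simp: psums_Cons)

section \<open>Group sums of a broken list\<close>

lemma break_at_neq_Nil [simp]: "break_at R xs = [] \<longleftrightarrow> xs = []"
  by (induction R xs rule: break_at.induct) auto

lemma concat_break_at [simp]: "concat (break_at R xs) = xs"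
proof (induction R xs rule: break_at.induct)
  case (3 R x y zs)
  obtain g gs where "break_at R (y # zs) = g # gs"
    by (metis break_at_neq_Nil list.distinct(1) neq_Nil_conv)
  then show ?case using 3 by auto
qed auto

lemma Nil_notin_break_at: "[] \<notin> set (break_at R xs)"
proof (induction R xs rule: break_at.induct)
  case (3 R x y zs)
  obtain g gs where "break_at R (y # zs) = g # gs"
    by (metis break_at_neq_Nil list.distinct(1) neq_Nil_conv)
  then show ?case using 3 by auto
qed auto

text \<open>The inner implication is vacuous at the last place, so the total is included. The weight
  \<open>f\<close> covers both uses: the identity on parts for \<open>comp_C\<close> and
  \<open>card\<close> on blocks for \<open>rho_C\<close>.\<close>

lemma psums_break_at:
  "psums (map (\<lambda>\<Theta>. sum_list (map f \<Theta>)) (break_at R xs)) =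
    {sum_list (take (Suc i) (map f xs)) | i. i < length xs \<and> (Suc i < length xs \<longrightarrow> R (xs ! i) (xs ! Suc i))}"
proof (induction R xs rule: break_at.induct)
  case (3 R x y zs)
  let ?S = "\<lambda>xs. {i. i < length xs \<and> (Suc i < length xs \<longrightarrow> R (xs ! i) (xs ! Suc i))}"
  let ?s = "\<lambda>xs i. sum_list (take (Suc i) (map f xs))"
  have im: "{?s xs i | i. i < length xs \<and> (Suc i < length xs \<longrightarrow> R (xs ! i) (xs ! Suc i))} = ?s xs ` ?S xs" for xs
    by auto
  obtain g gs where g: "break_at R (y # zs) = g # gs"
    by (metis break_at_neq_Nil list.distinct(1) neq_Nil_conv)
  have IH: "psums (map (\<lambda>\<Theta>. sum_list (map f \<Theta>)) (break_at R (y # zs))) = ?s (y # zs) ` ?S (y # zs)"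
    using 3 im by (cases "R x y") auto
  have S: "?S (x # y # zs) = (if R x y then insert 0 (Suc ` ?S (y # zs)) else Suc ` ?S (y # zs))"
    by (auto simp: image_iff less_Suc_eq_0_disj)
  have shift: "?s (x # y # zs) ` Suc ` A = (+) (f x) ` ?s (y # zs) ` A" for A
    by (simp add: image_image)
  \<comment> \<open>Without a cut, \<open>x\<close> enlarges the first group: all prefix sums shift
    by \<open>f x\<close> and none is added.\<close>
  have merge: "psums (map (\<lambda>\<Theta>. sum_list (map f \<Theta>)) ((x # g) # gs))
      = (+) (f x) ` psums (map (\<lambda>\<Theta>. sum_list (map f \<Theta>)) (g # gs))"
    by (simp add: psums_Cons image_image add.assoc)
  show ?case
  proof (cases "R x y")
    case True
    then show ?thesis unfolding im S by (simp add: psums_Cons IH shift[simplified])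
  next
    case False
    then show ?thesis unfolding im S using merge IH g shift by simp
  qed
qed (auto simp: psums_Cons)

lemma composition_break_at:
  assumes "\<forall>x\<in>set xs. 0 < f x"
  shows "composition (map (\<lambda>\<Theta>. sum_list (map f \<Theta>)) (break_at R xs))"
    (is "composition (map ?g _)")
proof -
  have "?g \<Theta> \<noteq> 0" if "\<Theta> \<in> set (break_at R xs)" for \<Theta>
  proof -
    have "\<Theta> \<noteq> []" using that Nil_notin_break_at by metis
    moreover have "set \<Theta> \<subseteq> set xs"
      using that by (metis UN_upper concat_break_at set_concat)
    ultimately show ?thesis using assms by (cases \<Theta>) auto
  qed
  then show ?thesis unfolding composition_def set_map image_iff by metis
qed

lemma sum_list_break_at:
  "sum_list (map (\<lambda>\<Theta>. sum_list (map f \<Theta>)) (break_at R xs)) = sum_list (map f (xs :: 'a list) :: nat list)"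
proof -
  have "sum_list (map (\<lambda>\<Theta>. sum_list (map f \<Theta>)) \<gamma>s) = sum_list (map f (concat \<gamma>s))" for \<gamma>s :: "'a list list"
    by (induction \<gamma>s) auto
  then show ?thesis by simp
qed

text \<open>\<open>transpose_comp\<close> complements inner prefix sums only, so the total has to
  survive; subtracting \<open>psums \<beta> - {sum_list \<beta>}\<close> keeps it.\<close>

lemma psums_transpose_comp:
  assumes "composition \<beta>"
  shows "composition (transpose_comp \<beta>) \<and> sum_list (transpose_comp \<beta>) = sum_list \<beta> \<and>
    psums (transpose_comp \<beta>) = {1..sum_list \<beta>} - (psums \<beta> - {sum_list \<beta>})"
proof -
  let ?n = "sum_list \<beta>"
  let ?P = "\<lambda>\<gamma>. composition \<gamma> \<and> sum_list \<gamma> = ?n \<and> comp_set \<gamma> = {1..<?n} - comp_set \<beta>"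
  let ?S = "{1..?n} - (psums \<beta> - {?n})"
  have iff: "?P \<gamma> \<longleftrightarrow> composition \<gamma> \<and> sum_list \<gamma> = ?n \<and> psums \<gamma> = ?S" for \<gamma>
  proof (cases "composition \<gamma> \<and> sum_list \<gamma> = ?n")
    case True
    have n: "?n \<in> psums \<gamma> \<longleftrightarrow> 0 < ?n"
      using True sum_list_mem_psums[of \<gamma>] psums_subset[of \<gamma>] by (cases "\<gamma> = []") auto
    have "A - {m} = {1..<m} - (X - {m}) \<longleftrightarrow> A = {1..m} - (X - {m})"
      if "m \<in> A \<longleftrightarrow> 0 < m" for m and A X :: "nat set"
    proof -
      have "A = (A - {m}) \<union> (if 0 < m then {m} else {})" using that by auto
      moreover have "{1..m} - (X - {m}) = ({1..<m} - (X - {m})) \<union> (if 0 < m then {m} else {})"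
        "{1..m} - (X - {m}) - {m} = {1..<m} - (X - {m})" by auto
      ultimately show ?thesis by metis
    qed
    note this[OF n]
    then show ?thesis using True assms by (simp add: comp_set_eq_psums)
  qed auto
  obtain \<gamma> where \<gamma>: "composition \<gamma>" "psums \<gamma> = ?S"
    using psums_surj[of ?S] by auto
  \<comment> \<open>\<open>psums_surj\<close> does not prescribe the total; it is the maximum of
    \<open>?S\<close>, or 0 when that set is empty.\<close>
  have "sum_list \<gamma> = ?n"
  proof (cases "?n = 0")
    case True
    then show ?thesis using \<gamma> sum_list_mem_psums[of \<gamma>] by (cases "\<gamma> = []") auto
  next
    case False
    then have "1 \<le> ?n" by linarith
    then have "?n \<in> psums \<gamma>"
      unfolding \<gamma>(2) by (simp only: Diff_iff atLeastAtMost_iff singleton_iff simp_thms order_refl)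
    moreover have "sum_list \<gamma> \<in> psums \<gamma>" using calculation by (intro sum_list_mem_psums) auto
    ultimately have "sum_list \<gamma> \<in> {1..?n}" "?n \<in> {1..sum_list \<gamma>}"
      using \<gamma> psums_subset[OF \<gamma>(1)] by blast+
    then show ?thesis by simp
  qed
  then have "\<exists>!\<gamma>. ?P \<gamma>" unfolding iff using \<gamma> psums_inject by blast
  then have "?P (transpose_comp \<beta>)" unfolding transpose_comp_def by (rule theI')
  then show ?thesis unfolding iff .
qed

text \<open>Within each group the inner prefix sums are complemented, while the end of a group is a
  prefix sum both before and after transposing. Hence only prefix sums that are not ends of groups
  are removed.\<close>

lemma psums_concat_transpose_comp:
  assumes "composition (concat \<gamma>s)" "[] \<notin> set \<gamma>s"
  shows "composition (concat (map transpose_comp \<gamma>s)) \<and>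
    sum_list (concat (map transpose_comp \<gamma>s)) = sum_list (concat \<gamma>s) \<and>
    psums (concat (map transpose_comp \<gamma>s)) =
      {1..sum_list (concat \<gamma>s)} - (psums (concat \<gamma>s) - psums (map sum_list \<gamma>s))"
  using assms
proof (induction \<gamma>s)
  case (Cons \<gamma> \<gamma>s)
  let ?g = "sum_list \<gamma>" and ?N = "sum_list (concat \<gamma>s)"
  have comp: "composition \<gamma>" "composition (concat \<gamma>s)" and "\<gamma> \<noteq> []"
    using Cons.prems by (auto simp: composition_append)
  note IH = Cons.IH[OF comp(2)] and t = psums_transpose_comp[OF comp(1)]
  have g: "?g \<in> psums \<gamma>" "psums \<gamma> \<subseteq> {1..?g}" "?g > 0"
    using sum_list_mem_psums[OF \<open>\<gamma> \<noteq> []\<close>] psums_subset[OF comp(1)] by auto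
  have N: "psums (concat \<gamma>s) \<subseteq> {1..?N}" by (rule psums_subset[OF comp(2)])
  have sub: "psums (map sum_list \<gamma>s) \<subseteq> psums (concat \<gamma>s)"
    using Cons.prems by (intro psums_map_sum_list_subset) auto
  have "({1..?g} - (psums \<gamma> - {?g})) \<union> (+) ?g ` ({1..?N} - (psums (concat \<gamma>s) - psums (map sum_list \<gamma>s)))
    = {1..?g + ?N} - ((psums \<gamma> \<union> (+) ?g ` psums (concat \<gamma>s)) - insert ?g ((+) ?g ` psums (map sum_list \<gamma>s)))"
    (is "?L = ?R")
  proof (rule set_eqI)
    fix x
    show "x \<in> ?L \<longleftrightarrow> x \<in> ?R"
    \<comment> \<open>Up to \<open>?g\<close> only the first group matters; beyond it, translation
      by \<open>?g\<close> leads to the remaining groups.\<close>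
    proof (cases "x \<le> ?g")
      case True
      then have nin: "x \<notin> (+) ?g ` A" if "0 \<notin> A" for A using that by auto
      have "0 \<notin> psums (concat \<gamma>s)" "0 \<notin> psums (map sum_list \<gamma>s)" using N sub by auto
      then have "x \<notin> (+) ?g ` ({1..?N} - (psums (concat \<gamma>s) - psums (map sum_list \<gamma>s)))"
          "x \<notin> (+) ?g ` psums (concat \<gamma>s)" "x \<notin> (+) ?g ` psums (map sum_list \<gamma>s)"
        by (intro nin; simp)+
      then show ?thesis using True by auto
    next
      case False
      then have eq: "x \<in> (+) ?g ` A \<longleftrightarrow> x - ?g \<in> A" for A by (auto intro!: image_eqI[of _ _ "x - ?g"])
      show ?thesis using False g by (auto simp: eq)
    qed
  qed
  then show ?case using IH t Cons.prems by (simp add: composition_append psums_append psums_Cons)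
qed simp


section \<open>Permutations preserving the classes of a colouring\<close>

text \<open>The Young subgroup of the colouring \<open>c\<close>, the product of the symmetric
  groups on its fibres. Colouring places by block size gives \<open>block_perms\<close>; the piece
  as a second colour gives the subgroup that also preserves pieces.\<close>

definition class_perms :: "'a set \<Rightarrow> ('a \<Rightarrow> 'b) \<Rightarrow> ('a \<Rightarrow> 'a) set" where
  "class_perms P c = {\<sigma>. \<sigma> permutes P \<and> (\<forall>i\<in>P. c (\<sigma> i) = c i)}"

lemma class_perms_permutes: "\<sigma> \<in> class_perms P c \<Longrightarrow> \<sigma> permutes P"
  by (simp add: class_perms_def)

lemma finite_class_perms: "finite P \<Longrightarrow> finite (class_perms P c)"
  unfolding class_perms_def by (rule finite_subset[OF _ finite_permutations]) auto

lemma class_perms_compose: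
  "\<sigma> \<in> class_perms P c \<Longrightarrow> \<tau> \<in> class_perms P c \<Longrightarrow> \<sigma> \<circ> \<tau> \<in> class_perms P c"
  by (auto simp: class_perms_def permutes_compose permutes_in_image)

lemma class_perms_inv:
  assumes "\<sigma> \<in> class_perms P c"
  shows "inv \<sigma> \<in> class_perms P c"
proof -
  have \<sigma>: "\<sigma> permutes P" "\<And>i. i \<in> P \<Longrightarrow> c (\<sigma> i) = c i" using assms by (auto simp: class_perms_def)
  have "c (inv \<sigma> i) = c i" if "i \<in> P" for i
    using \<sigma>(2)[of "inv \<sigma> i"] that permutes_inv[OF \<sigma>(1)]
    by (simp add: permutes_in_image permutes_inverses[OF \<sigma>(1)])
  then show ?thesis using permutes_inv[OF \<sigma>(1)] by (auto simp: class_perms_def)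
qed

lemma class_perms_transpose:
  "i \<in> P \<Longrightarrow> j \<in> P \<Longrightarrow> c i = c j \<Longrightarrow> transpose i j \<in> class_perms P c"
  by (auto simp: class_perms_def permutes_swap_id transpose_def)

lemma class_perms_refine:
  assumes "\<And>i j. i \<in> P \<Longrightarrow> j \<in> P \<Longrightarrow> d i = d j \<Longrightarrow> c i = c j"
  shows "class_perms P d \<subseteq> class_perms P c"
proof
  fix \<sigma> assume \<sigma>: "\<sigma> \<in> class_perms P d"
  have "c (\<sigma> i) = c i" if "i \<in> P" for i
    by (rule assms) (use that \<sigma> in \<open>simp_all add: class_perms_def permutes_in_image\<close>)
  then show "\<sigma> \<in> class_perms P c" using \<sigma> by (simp add: class_perms_def)
qed

text \<open>A permutation is split into the image \<open>q\<close> of \<open>p\<close> and what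
  remains after \<open>q\<close> is swapped back to \<open>p\<close>; the remainder fixes
  \<open>p\<close>, and \<open>q\<close> ranges over the class of \<open>p\<close>.\<close>

lemma class_perms_insert:
  assumes "p \<notin> P"
  shows "bij_betw (\<lambda>(q, \<sigma>). transpose p q \<circ> \<sigma>)
    ({q \<in> insert p P. c q = c p} \<times> class_perms P c) (class_perms (insert p P) c)"
proof (rule bij_betw_byWitness[where f' = "\<lambda>\<sigma>. (\<sigma> p, transpose p (\<sigma> p) \<circ> \<sigma>)"])
  show "\<forall>x\<in>{q \<in> insert p P. c q = c p} \<times> class_perms P c.
      (\<lambda>\<sigma>. (\<sigma> p, transpose p (\<sigma> p) \<circ> \<sigma>)) ((\<lambda>(q, \<sigma>). transpose p q \<circ> \<sigma>) x) = x"
    using assms by (auto simp: class_perms_def permutes_not_in o_assoc)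
  show "\<forall>\<sigma>\<in>class_perms (insert p P) c.
      (\<lambda>(q, \<sigma>). transpose p q \<circ> \<sigma>) ((\<lambda>\<sigma>. (\<sigma> p, transpose p (\<sigma> p) \<circ> \<sigma>)) \<sigma>) = \<sigma>"
    by (auto simp: o_assoc)
  have sub: "class_perms P c \<subseteq> class_perms (insert p P) c"
    using assms by (auto simp: class_perms_def permutes_not_in intro: permutes_subset)
  show "(\<lambda>(q, \<sigma>). transpose p q \<circ> \<sigma>) ` ({q \<in> insert p P. c q = c p} \<times> class_perms P c)
      \<subseteq> class_perms (insert p P) c"
    using sub by (auto intro!: class_perms_compose class_perms_transpose simp del: insert_iff)
  show "(\<lambda>\<sigma>. (\<sigma> p, transpose p (\<sigma> p) \<circ> \<sigma>)) ` class_perms (insert p P) c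
      \<subseteq> {q \<in> insert p P. c q = c p} \<times> class_perms P c"
  proof (rule image_subsetI)
    fix \<sigma> assume \<sigma>: "\<sigma> \<in> class_perms (insert p P) c"
    then have p: "\<sigma> p \<in> insert p P" "c (\<sigma> p) = c p"
      by (auto simp: class_perms_def permutes_in_image simp del: insert_iff)
    let ?\<tau> = "transpose p (\<sigma> p) \<circ> \<sigma>"
    have "?\<tau> \<in> class_perms (insert p P) c"
      using \<sigma> p by (intro class_perms_compose class_perms_transpose) auto
    moreover have "?\<tau> p = p" by simp
    ultimately have "?\<tau> \<in> class_perms P c"
      by (auto simp: class_perms_def intro!: permutes_superset[of _ "insert p P"])
    then show "(\<sigma> p, ?\<tau>) \<in> {q \<in> insert p P. c q = c p} \<times> class_perms P c" using p by simp
  qed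
qed

text \<open>A new point multiplies the order by the size of its enlarged class, the step from m! to
  (m + 1)!.\<close>

lemma card_class_perms:
  assumes "finite P"
  shows "card (class_perms P c) = (\<Prod>x\<in>c ` P. fact (card {i \<in> P. c i = x}))"
  using assms
proof (induction P rule: finite_induct)
  case empty
  then show ?case by (simp add: class_perms_def)
next
  case (insert p P)
  define m where "m P x = card {i \<in> P. c i = x}" for P x
  have m: "m (insert p P) x = (if x = c p then Suc (m P x) else m P x)" for x
  proof -
    have "{i \<in> insert p P. c i = x} = (if x = c p then insert p {i \<in> P. c i = x} else {i \<in> P. c i = x})"
      by auto
    then show ?thesis using insert.hyps by (simp add: m_def)
  qed
  have "(\<Prod>x\<in>c ` insert p P. fact (m (insert p P) x) :: nat)
      = fact (m (insert p P) (c p)) * (\<Prod>x\<in>c ` insert p P - {c p}. fact (m (insert p P) x))"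
    using insert.hyps by (intro prod.remove) auto
  also have "\<dots> = Suc (m P (c p)) * (fact (m P (c p)) * (\<Prod>x\<in>c ` insert p P - {c p}. fact (m P x)))"
    by (simp add: m algebra_simps)
  also have "fact (m P (c p)) * (\<Prod>x\<in>c ` insert p P - {c p}. fact (m P x) :: nat) = (\<Prod>x\<in>c ` insert p P. fact (m P x))"
    using insert.hyps by (intro prod.remove[symmetric]) auto
  \<comment> \<open>If the colour of \<open>p\<close> is new, its class in \<open>P\<close> is empty
    and contributes 0! = 1.\<close>
  also have "(\<Prod>x\<in>c ` insert p P. fact (m P x) :: nat) = (\<Prod>x\<in>c ` P. fact (m P x))"
  proof (rule prod.mono_neutral_right)
    show "\<forall>x\<in>c ` insert p P - c ` P. fact (m P x) = (1 :: nat)"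
    proof
      fix x assume "x \<in> c ` insert p P - c ` P"
      then have "{i \<in> P. c i = x} = {}" by auto
      then show "fact (m P x) = (1 :: nat)" by (simp only: m_def card.empty fact_0)
    qed
  qed (use insert.hyps in auto)
  also have "\<dots> = card (class_perms P c)" using insert.IH by (simp add: m_def)
  also have "Suc (m P (c p)) = card {q \<in> insert p P. c q = c p}" using m[of "c p"] by (simp only: m_def if_True refl)
  also have "card {q \<in> insert p P. c q = c p} * card (class_perms P c) = card (class_perms (insert p P) c)"
    using bij_betw_same_card[OF class_perms_insert[OF insert.hyps(2)]] by (simp only: card_cartesian_product)
  finally show ?case by (simp only: m_def)
qed

text \<open>For \<open>d\<close> finer than \<open>c\<close> and \<open>v\<close> injective, these
  represent the left cosets of \<open>class_perms P d\<close> in \<open>class_perms P c\<close>: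
  composing on the right permutes the places within each class of \<open>d\<close>, and exactly one
  arrangement makes the ranks \<open>v\<close> increase there.\<close>

definition sorted_class_perms ::
    "'a::linorder set \<Rightarrow> ('a \<Rightarrow> 'b) \<Rightarrow> ('a \<Rightarrow> 'c) \<Rightarrow> ('a \<Rightarrow> nat) \<Rightarrow> ('a \<Rightarrow> 'a) set" where
  "sorted_class_perms P c d v = {\<sigma> \<in> class_perms P c.
     \<forall>i\<in>P. \<forall>j\<in>P. i < j \<longrightarrow> d i = d j \<longrightarrow> v (\<sigma> i) < v (\<sigma> j)}"

text \<open>Transposing an inversion within a class increases \<open>\<Sum>i\<in>P. i * v (\<sigma> (\<tau> i))\<close>, so a maximiser is sorted.\<close>

lemma ex_sorted_class_perm:
  fixes P :: "nat set"
  assumes P: "finite P" and v: "inj_on v P" and \<sigma>: "\<sigma> \<in> class_perms P c"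
    and refines: "\<And>i j. i \<in> P \<Longrightarrow> j \<in> P \<Longrightarrow> d i = d j \<Longrightarrow> c i = c j"
  obtains \<tau> where "\<tau> \<in> class_perms P d" "\<sigma> \<circ> \<tau> \<in> sorted_class_perms P c d v"
proof -
  let ?w = "\<lambda>\<tau>. \<Sum>i\<in>P. int i * int (v (\<sigma> (\<tau> i)))"
  have "finite (class_perms P d)" "class_perms P d \<noteq> {}"
    using finite_class_perms[OF P] by (auto simp: class_perms_def intro!: exI[of _ id] permutes_id)
  then have fin: "finite (?w ` class_perms P d)" and "Max (?w ` class_perms P d) \<in> ?w ` class_perms P d"
    by (auto intro: Max_in)
  then obtain \<tau> where \<tau>: "\<tau> \<in> class_perms P d" and w: "?w \<tau> = Max (?w ` class_perms P d)"
    by auto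
  have max: "?w \<tau>' \<le> ?w \<tau>" if "\<tau>' \<in> class_perms P d" for \<tau>'
    unfolding w by (rule Max_ge[OF fin imageI[OF that]])
  have perm: "\<sigma> \<circ> \<tau> permutes P"
    by (rule permutes_compose[OF class_perms_permutes[OF \<tau>] class_perms_permutes[OF \<sigma>]])
  have "\<tau> \<in> class_perms P c"
    by (rule subsetD[OF class_perms_refine[of P d c, OF refines] \<tau>])
  with \<sigma> have comp: "\<sigma> \<circ> \<tau> \<in> class_perms P c" by (rule class_perms_compose)
  have "v (\<sigma> (\<tau> i)) < v (\<sigma> (\<tau> j))" if ij: "i \<in> P" "j \<in> P" "i < j" "d i = d j" for i j
  proof (rule ccontr)
    assume "\<not> ?thesis"
    moreover have "v (\<sigma> (\<tau> i)) \<noteq> v (\<sigma> (\<tau> j))"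
    proof
      assume "v (\<sigma> (\<tau> i)) = v (\<sigma> (\<tau> j))"
      then have "(\<sigma> \<circ> \<tau>) i = (\<sigma> \<circ> \<tau>) j"
        using v ij permutes_in_image[OF perm] by (auto simp: inj_on_def)
      then have "i = j" by (rule injD[OF permutes_inj[OF perm]])
      then show False using ij by simp
    qed
    ultimately have less: "v (\<sigma> (\<tau> j)) < v (\<sigma> (\<tau> i))" by simp
    let ?\<tau>' = "\<tau> \<circ> transpose i j"
    have "?\<tau>' \<in> class_perms P d"
      using \<tau> ij by (intro class_perms_compose class_perms_transpose) auto
    then have "?w ?\<tau>' \<le> ?w \<tau>" by (rule max)
    moreover have "?w \<tau>' = (\<Sum>k\<in>P - {i, j}. int k * int (v (\<sigma> (\<tau>' k))))
        + int i * int (v (\<sigma> (\<tau>' i))) + int j * int (v (\<sigma> (\<tau>' j)))" for \<tau>'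
      using P ij by (subst sum.subset_diff[of "{i, j}"]) auto
    moreover have "(\<Sum>k\<in>P - {i, j}. int k * int (v (\<sigma> (?\<tau>' k)))) = (\<Sum>k\<in>P - {i, j}. int k * int (v (\<sigma> (\<tau> k))))"
      by (intro sum.cong) (auto simp: transpose_def)
    \<comment> \<open>The product is the change of \<open>?w\<close> caused by the transposition:
      the terms at \<open>i\<close> and \<open>j\<close> trade values and all others stay.\<close>
    ultimately have "(int j - int i) * (int (v (\<sigma> (\<tau> i))) - int (v (\<sigma> (\<tau> j)))) \<le> 0"
      by (simp add: algebra_simps)
    moreover have "0 < (int j - int i) * (int (v (\<sigma> (\<tau> i))) - int (v (\<sigma> (\<tau> j))))"
      using less ij by (intro mult_pos_pos) auto
    ultimately show False by linarith
  qed
  then have "\<sigma> \<circ> \<tau> \<in> sorted_class_perms P c d v" using comp by (auto simp: sorted_class_perms_def)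
  with \<tau> show thesis by (rule that)
qed

text \<open>At the least point \<open>i\<close> moved by \<kappa>, both \<open>\<kappa> i\<close>
  and the preimage of \<open>i\<close> lie above \<open>i\<close> in its class. Sortedness of
  \<sigma> gives \<open>\<sigma> i\<close> a smaller rank than \<open>\<sigma> (\<kappa> i)\<close>,
  and sortedness of \<open>\<sigma> \<circ> \<kappa>\<close> gives it a larger one.\<close>

lemma sorted_class_perm_unique:
  fixes P :: "nat set"
  assumes \<kappa>: "\<kappa> \<in> class_perms P d"
    and \<sigma>: "\<sigma> \<in> sorted_class_perms P c d v" and \<sigma>\<kappa>: "\<sigma> \<circ> \<kappa> \<in> sorted_class_perms P c d v"
  shows "\<kappa> = id"
proof (rule ccontr)
  assume "\<kappa> \<noteq> id"
  then obtain i0 where "\<kappa> i0 \<noteq> i0" by (auto simp: fun_eq_iff)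
  define i where "i = (LEAST i. \<kappa> i \<noteq> i)"
  have i: "\<kappa> i \<noteq> i" unfolding i_def by (rule LeastI) fact
  have least: "\<kappa> j = j" if "j < i" for j using not_less_Least[of j "\<lambda>i. \<kappa> i \<noteq> i"] that by (auto simp: i_def)
  have perm: "\<kappa> permutes P" and d: "\<And>j. j \<in> P \<Longrightarrow> d (\<kappa> j) = d j" using \<kappa> by (auto simp: class_perms_def)
  have "i \<in> P" using i perm by (auto simp: permutes_def)
  have P: "\<kappa> i \<in> P" using \<open>i \<in> P\<close> perm by (simp add: permutes_in_image)
  obtain j where j: "\<kappa> j = i" using perm by (metis permutes_inverses(1))
  have "j \<in> P" using j \<open>i \<in> P\<close> perm by (metis permutes_in_image)
  have "i < \<kappa> i"
    using i least[of "\<kappa> i"] permutes_inj[OF perm] by (metis injD linorder_neqE_nat)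
  moreover have "i < j" using i j least[of j] by (metis linorder_neqE_nat)
  moreover have "d i = d (\<kappa> i)" "d i = d j" using d \<open>i \<in> P\<close> \<open>j \<in> P\<close> j by metis+
  ultimately have "v (\<sigma> i) < v (\<sigma> (\<kappa> i))" "v (\<sigma> (\<kappa> i)) < v (\<sigma> (\<kappa> j))"
    using \<sigma> \<sigma>\<kappa> P \<open>i \<in> P\<close> \<open>j \<in> P\<close> by (auto simp: sorted_class_perms_def)
  then show False using j by simp
qed

text \<open>Each element is uniquely a sorted one composed on the right with a permutation within
  the classes of \<open>d\<close>. The index of the subgroup appears as a product to stay within the
  natural numbers.\<close>

lemma card_sorted_class_perms:
  fixes P :: "nat set"
  assumes P: "finite P" and v: "inj_on v P"
    and refines: "\<And>i j. i \<in> P \<Longrightarrow> j \<in> P \<Longrightarrow> d i = d j \<Longrightarrow> c i = c j"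
  shows "card (sorted_class_perms P c d v) * card (class_perms P d) = card (class_perms P c)"
proof -
  have sub: "class_perms P d \<subseteq> class_perms P c"
    by (rule class_perms_refine[of P d c, OF refines])
  let ?f = "\<lambda>(\<sigma>, \<tau>). \<sigma> \<circ> \<tau>"
  have "bij_betw ?f (sorted_class_perms P c d v \<times> class_perms P d) (class_perms P c)"
    unfolding bij_betw_def
  proof
    show "inj_on ?f (sorted_class_perms P c d v \<times> class_perms P d)"
    proof (rule inj_onI, clarify)
      fix \<sigma> \<tau> \<sigma>' \<tau>'
      assume \<sigma>: "\<sigma> \<in> sorted_class_perms P c d v" "\<sigma>' \<in> sorted_class_perms P c d v"
        and \<tau>: "\<tau> \<in> class_perms P d" "\<tau>' \<in> class_perms P d" and eq: "\<sigma> \<circ> \<tau> = \<sigma>' \<circ> \<tau>'"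
      \<comment> \<open>Equal products make the two sorted factors differ by this element of the
        subgroup, which must be the identity.\<close>
      let ?\<kappa> = "\<tau> \<circ> inv \<tau>'"
      have "\<sigma> \<circ> ?\<kappa> = \<sigma>' \<circ> \<tau>' \<circ> inv \<tau>'" by (simp only: o_assoc eq)
      also have "\<dots> = \<sigma>'" using permutes_inv_o(1)[OF class_perms_permutes[OF \<tau>(2)]] by (simp only: o_assoc[symmetric] o_id)
      finally have \<sigma>': "\<sigma> \<circ> ?\<kappa> = \<sigma>'" .
      moreover have "?\<kappa> \<in> class_perms P d" using \<tau> by (intro class_perms_compose class_perms_inv)
      ultimately have "?\<kappa> = id" using sorted_class_perm_unique \<sigma> by metis
      have "\<tau> = \<tau> \<circ> (inv \<tau>' \<circ> \<tau>')" using permutes_inv_o(2)[OF class_perms_permutes[OF \<tau>(2)]] by simp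
      also have "\<dots> = \<tau>'" using \<open>?\<kappa> = id\<close> by (simp only: o_assoc id_o)
      finally have "\<tau> = \<tau>'" .
      then show "\<sigma> = \<sigma>' \<and> \<tau> = \<tau>'" using \<sigma>' \<open>?\<kappa> = id\<close> by simp
    qed
    show "?f ` (sorted_class_perms P c d v \<times> class_perms P d) = class_perms P c"
    proof (intro equalityI subsetI)
      fix \<sigma> assume \<sigma>: "\<sigma> \<in> class_perms P c"
      obtain \<tau> where \<tau>: "\<tau> \<in> class_perms P d" "\<sigma> \<circ> \<tau> \<in> sorted_class_perms P c d v"
        by (rule ex_sorted_class_perm[where c = c and d = d, OF P v \<sigma> refines])
      have "\<sigma> = ?f (\<sigma> \<circ> \<tau>, inv \<tau>)"
        using permutes_inv_o(1)[OF class_perms_permutes[OF \<tau>(1)]] by (simp add: o_assoc[symmetric])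
      then show "\<sigma> \<in> ?f ` (sorted_class_perms P c d v \<times> class_perms P d)"
        using \<tau> class_perms_inv by blast
    qed (use sub in \<open>auto simp: sorted_class_perms_def intro!: class_perms_compose\<close>)
  qed
  from bij_betw_same_card[OF this] show ?thesis by (simp add: card_cartesian_product)
qed


section \<open>The image of \<open>P\<^sub>\<Phi>\<close> under \<open>\<rho>\<close>\<close>

lemma composition_map_iff: "composition (map f xs) \<longleftrightarrow> (\<forall>x\<in>set xs. 0 < f x)"
  by (auto simp: composition_def image_iff)

text \<open>The prefix sums of the broken list are those at its cuts and the total. The latter is a
  prefix sum of \<beta> already, so only the cuts remain to be checked.\<close>

lemma comp_le_break_at_iff:
  fixes f :: "'a \<Rightarrow> nat"
  assumes "map f xs \<preceq>\<^sub>P \<beta>"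
  shows "\<beta> \<preceq>\<^sub>P map (\<lambda>\<Theta>. sum_list (map f \<Theta>)) (break_at R xs) \<longleftrightarrow>
    (\<forall>i. Suc i < length xs \<longrightarrow> R (xs ! i) (xs ! Suc i) \<longrightarrow> sum_list (take (Suc i) (map f xs)) \<in> psums \<beta>)"
    (is "_ \<preceq>\<^sub>P ?C \<longleftrightarrow> ?rhs")
proof -
  let ?s = "\<lambda>i. sum_list (take (Suc i) (map f xs))"
  have comp: "composition (map f xs)" "composition \<beta>" and sum: "sum_list (map f xs) = sum_list \<beta>"
    using assms by (auto simp: comp_le_iff)
  have C: "composition ?C" "sum_list ?C = sum_list \<beta>"
    using comp(1) composition_break_at[of xs f R] by (auto simp: composition_map_iff sum_list_break_at sum)
  have last: "?s i \<in> psums \<beta>" if "i < length xs" "\<not> Suc i < length xs" for i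
  proof -
    have "?s i = sum_list (map f xs)" using that by simp
    moreover have "sum_list (map f xs) \<in> psums (map f xs)" using that by (intro sum_list_mem_psums) auto
    then have "sum_list (map f xs) > 0" using psums_subset[OF comp(1)] by fastforce
    then have "\<beta> \<noteq> []" using sum by auto
    ultimately show ?thesis using sum_list_mem_psums[of \<beta>] sum by simp
  qed
  have "\<beta> \<preceq>\<^sub>P ?C \<longleftrightarrow> psums ?C \<subseteq> psums \<beta>" using comp C by (simp add: comp_le_iff)
  also have "\<dots> \<longleftrightarrow> (\<forall>i. i < length xs \<and> (Suc i < length xs \<longrightarrow> R (xs ! i) (xs ! Suc i)) \<longrightarrow> ?s i \<in> psums \<beta>)"
    unfolding psums_break_at by blast
  also have "\<dots> \<longleftrightarrow> ?rhs" using last Suc_lessD by blast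
  finally show ?thesis .
qed

lemma comp_C_eq: "comp_C prec \<alpha> = map (\<lambda>\<Theta>. sum_list (map id \<Theta>)) (break_at prec \<alpha>)"
  by (simp add: comp_C_def)

lemma rho_C_eq: "rho_C tri \<Phi> = map (\<lambda>\<Theta>. sum_list (map card \<Theta>)) (break_at (\<lambda>A B. tri B A) \<Phi>)"
  by (simp add: rho_C_def block_sizes_def)

lemma comp_le_comp_C_iff:
  assumes "\<alpha> \<preceq>\<^sub>P \<beta>"
  shows "\<beta> \<preceq>\<^sub>P comp_C prec \<alpha> \<longleftrightarrow>
    (\<forall>i. Suc i < length \<alpha> \<longrightarrow> prec (\<alpha> ! i) (\<alpha> ! Suc i) \<longrightarrow> sum_list (take (Suc i) \<alpha>) \<in> psums \<beta>)"
  using comp_le_break_at_iff[of id \<alpha> \<beta> prec] assms unfolding comp_C_eq by simp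

lemma comp_le_rho_C_iff:
  assumes "block_sizes \<Phi> \<preceq>\<^sub>P \<beta>"
  shows "\<beta> \<preceq>\<^sub>P rho_C tri \<Phi> \<longleftrightarrow>
    (\<forall>i. Suc i < length \<Phi> \<longrightarrow> tri (\<Phi> ! Suc i) (\<Phi> ! i) \<longrightarrow>
      sum_list (take (Suc i) (block_sizes \<Phi>)) \<in> psums \<beta>)"
  using comp_le_break_at_iff[of card \<Phi> \<beta> "\<lambda>A B. tri B A"] assms
  unfolding rho_C_eq block_sizes_def by simp

lemma block_sizes_le_rho_C:
  assumes "\<forall>B\<in>set \<Phi>. finite B \<and> B \<noteq> {}"
  shows "block_sizes \<Phi> \<preceq>\<^sub>P rho_C tri \<Phi>"
proof -
  have "block_sizes \<Phi> \<preceq>\<^sub>P block_sizes \<Phi>"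
    using composition_block_sizes[OF assms] by (simp add: comp_le_iff)
  then show ?thesis by (subst comp_le_rho_C_iff) (auto simp: psums_def)
qed

lemma rho_sum: "rho (sum f A) = (\<Sum>x\<in>A. rho (f x))"
proof -
  have "rho 0 = 0" by (simp add: rho_def)
  then show ?thesis
    by (induction A rule: infinite_finite_induct) (simp_all add: rho_add)
qed

lemma sum_block_sizes_merge_at:
  assumes "sorted_wrt (\<lambda>A B. A \<inter> B = {}) \<Phi>" "\<forall>B\<in>set \<Phi>. finite B"
  shows "sum_list (block_sizes (merge_at I \<Phi>)) = sum_list (block_sizes \<Phi>)"
  using assms
proof (induction I \<Phi> rule: merge_at.induct)
  case (3 I B B' Bs)
  then show ?case by (auto simp: Int_Un_distrib2 card_Un_disjoint)
qed auto

lemma strict_total_order_on_flip: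
  assumes "strict_total_order_on A R" "x \<in> A" "y \<in> A" "x \<noteq> y"
  shows "\<not> R x y \<longleftrightarrow> R y x"
  using assms unfolding strict_total_order_on_def irreflp_on_def transp_on_def totalp_on_def by metis

text \<open>\<open>P_nc\<close> sums over a set of merged lists, so reindexing needs distinct lists
  to have distinct sizes: the deleted prefix sums determine the merged places. As the order is
  strict and total, an interior place may be merged exactly when it is not a cut of
  \<open>rho_C\<close>.\<close>

lemma rho_P_nc:
  assumes disj: "sorted_wrt (\<lambda>A B. A \<inter> B = {}) \<Phi>" and blocks: "\<forall>B\<in>set \<Phi>. finite B \<and> B \<noteq> {}"
    and "distinct \<Phi>" and ord: "strict_total_order_on (set \<Phi>) tri"
  shows "rho (P_nc tri \<Phi>) = (\<Sum>\<beta> | block_sizes \<Phi> \<preceq>\<^sub>P \<beta> \<and> \<beta> \<preceq>\<^sub>P rho_C tri \<Phi>. M_qsym \<beta>)"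
proof -
  let ?\<alpha> = "block_sizes \<Phi>" and ?k = "length \<Phi>"
  let ?V = "{\<beta>. ?\<alpha> \<preceq>\<^sub>P \<beta> \<and> \<beta> \<preceq>\<^sub>P rho_C tri \<Phi>}"
  define s where "s i = sum_list (take (Suc i) ?\<alpha>)" for i
  define D where "D = {i. Suc i < ?k \<and> tri (\<Phi> ! i) (\<Phi> ! Suc i)}"
  have comp: "composition ?\<alpha>" by (rule composition_block_sizes[OF blocks])
  have inj: "inj_on s {..<?k}" using inj_on_prefix_sums[OF comp] by (simp add: s_def[abs_def])
  have psums: "psums ?\<alpha> = s ` {..<?k}" by (simp add: psums_eq_image s_def[abs_def])
  have merge: "composition (block_sizes (merge_at I \<Phi>))" "sum_list (block_sizes (merge_at I \<Phi>)) = sum_list ?\<alpha>" for I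
    using composition_block_sizes[OF merge_at_nonempty[OF blocks]] sum_block_sizes_merge_at[OF disj] blocks
    by simp_all
  have psums_merge: "psums (block_sizes (merge_at I \<Phi>)) = psums ?\<alpha> - s ` I" if "I \<subseteq> {i. Suc i < ?k}" for I
    using psums_merge_at[OF disj blocks that] by (simp add: s_def[abs_def])
  have flip: "\<not> tri (\<Phi> ! i) (\<Phi> ! Suc i) \<longleftrightarrow> tri (\<Phi> ! Suc i) (\<Phi> ! i)" if "Suc i < ?k" for i
    using that \<open>distinct \<Phi>\<close> by (intro strict_total_order_on_flip[OF ord]) (auto simp: nth_eq_iff_index_eq)
  have merges: "merges tri \<Phi> = (\<lambda>I. merge_at I \<Phi>) ` Pow D"
    by (auto simp: merges_def D_def)
  have D: "D \<subseteq> {i. Suc i < ?k}" by (auto simp: D_def)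
  have "bij_betw block_sizes (merges tri \<Phi>) ?V"
    unfolding bij_betw_def
  proof
    show "inj_on block_sizes (merges tri \<Phi>)"
      unfolding merges
    proof (rule inj_onI, clarify)
      fix I J assume IJ: "I \<subseteq> D" "J \<subseteq> D" "block_sizes (merge_at I \<Phi>) = block_sizes (merge_at J \<Phi>)"
      have sub: "I \<subseteq> {..<?k}" "J \<subseteq> {..<?k}" using IJ D by auto
      have "psums ?\<alpha> - s ` I = psums ?\<alpha> - s ` J" using IJ D psums_merge by (metis subset_trans)
      moreover have "s ` I \<subseteq> psums ?\<alpha>" "s ` J \<subseteq> psums ?\<alpha>" using sub psums by auto
      ultimately have "s ` I = s ` J" by blast
      then have "I = J" using inj_on_image_eq_iff[OF inj sub] by simp
      then show "merge_at I \<Phi> = merge_at J \<Phi>" by simp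
    qed
    show "block_sizes ` merges tri \<Phi> = ?V"
    proof (intro equalityI subsetI)
      fix \<beta> assume "\<beta> \<in> block_sizes ` merges tri \<Phi>"
      then obtain I where I: "I \<subseteq> D" "\<beta> = block_sizes (merge_at I \<Phi>)" unfolding merges by auto
      then have ps: "psums \<beta> = psums ?\<alpha> - s ` I" using D psums_merge by auto
      then have le: "?\<alpha> \<preceq>\<^sub>P \<beta>" using merge comp I by (auto simp: comp_le_iff)
      have "s i \<in> psums \<beta>" if i: "Suc i < ?k" "tri (\<Phi> ! Suc i) (\<Phi> ! i)" for i
      proof -
        have "i \<notin> I" using I i flip[of i] by (auto simp: D_def)
        then have "s i \<notin> s ` I" using inj i I D by (intro notI) (auto dest!: inj_onD simp: subset_iff)
        then show ?thesis using ps psums i by auto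
      qed
      then show "\<beta> \<in> ?V" using le by (simp add: comp_le_rho_C_iff s_def)
    next
      fix \<beta> assume \<beta>: "\<beta> \<in> ?V"
      \<comment> \<open>The last place is excluded because no block follows it; its prefix sum is
        the total, which \<beta> keeps.\<close>
      define I where "I = {i. Suc i < ?k \<and> s i \<notin> psums \<beta>}"
      have "I \<subseteq> D"
        using \<beta> flip comp_le_rho_C_iff[of \<Phi> \<beta> tri] by (auto simp: I_def D_def s_def)
      have \<beta>': "composition \<beta>" "psums \<beta> \<subseteq> psums ?\<alpha>" "sum_list ?\<alpha> = sum_list \<beta>"
        using \<beta> by (auto simp: comp_le_iff)
      have last: "s i \<in> psums \<beta>" if "i < ?k" "\<not> Suc i < ?k" for i
      proof -
        have "s i = sum_list ?\<alpha>" using that by (simp add: s_def)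
        moreover have "s i \<in> psums ?\<alpha>" using that psums by auto
        then have "s i > 0" using psums_subset[OF comp] by fastforce
        ultimately have "\<beta> \<noteq> []" "s i = sum_list \<beta>" using \<beta>'(3) by auto
        then show ?thesis using sum_list_mem_psums by simp
      qed
      have "psums ?\<alpha> - s ` I = psums \<beta>"
      proof (intro equalityI subsetI)
        fix x assume x: "x \<in> psums ?\<alpha> - s ` I"
        then obtain i where "i < ?k" "x = s i" "i \<notin> I" using psums by auto
        then show "x \<in> psums \<beta>" using last by (cases "Suc i < ?k") (auto simp: I_def)
      next
        fix x assume "x \<in> psums \<beta>"
        then show "x \<in> psums ?\<alpha> - s ` I" using \<beta>'(2) by (auto simp: I_def)
      qed
      then have "psums (block_sizes (merge_at I \<Phi>)) = psums \<beta>"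
        using psums_merge[of I] by (auto simp: I_def)
      then have "\<beta> = block_sizes (merge_at I \<Phi>)" using psums_inject merge(1) \<beta>'(1) by metis
      then show "\<beta> \<in> block_sizes ` merges tri \<Phi>" unfolding merges using \<open>I \<subseteq> D\<close> by blast
    qed
  qed
  then have "(\<Sum>\<Psi>\<in>merges tri \<Phi>. M_qsym (block_sizes \<Psi>)) = (\<Sum>\<beta>\<in>?V. M_qsym \<beta>)"
    by (rule sum.reindex_bij_betw)
  then show ?thesis by (simp only: P_nc_def rho_sum rho_M_nc)
qed

text \<open>The inner difference consists of the prefix sums at places where \<open>break_at\<close>
  does not cut, so this is the description of \<open>rho_T\<close> as a complement, with the total
  added.\<close>

lemma psums_rho_T:
  assumes "\<forall>B\<in>set \<Phi>. finite B \<and> B \<noteq> {}"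
  shows "composition (rho_T tri \<Phi>)" "sum_list (rho_T tri \<Phi>) = sum_list (block_sizes \<Phi>)"
    "psums (rho_T tri \<Phi>) =
      {1..sum_list (block_sizes \<Phi>)} - (psums (block_sizes \<Phi>) - psums (rho_C tri \<Phi>))"
proof -
  let ?\<gamma>s = "map block_sizes (break_at (\<lambda>A B. tri B A) \<Phi>)"
  have conc: "concat ?\<gamma>s = block_sizes \<Phi>"
    unfolding block_sizes_def map_concat[symmetric] by simp
  have T: "rho_T tri \<Phi> = concat (map transpose_comp ?\<gamma>s)" by (simp add: rho_T_def o_def)
  have C: "rho_C tri \<Phi> = map sum_list ?\<gamma>s" by (simp add: rho_C_def o_def)
  have "[] \<notin> set ?\<gamma>s"
    using Nil_notin_break_at[of "\<lambda>A B. tri B A" \<Phi>] by (auto simp: block_sizes_def)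
  then show "composition (rho_T tri \<Phi>)" "sum_list (rho_T tri \<Phi>) = sum_list (block_sizes \<Phi>)"
    "psums (rho_T tri \<Phi>) =
      {1..sum_list (block_sizes \<Phi>)} - (psums (block_sizes \<Phi>) - psums (rho_C tri \<Phi>))"
    using psums_concat_transpose_comp[of ?\<gamma>s] composition_block_sizes[OF assms]
    unfolding conc C T by simp_all
qed

section \<open>Expansion in fundamental quasisymmetric functions\<close>

lemma sum_apply: "(\<Sum>x\<in>A. f x) y = (\<Sum>x\<in>A. (f x :: _ \<Rightarrow> _ :: comm_monoid_add) y)"
  by (induction A rule: infinite_finite_induct) (simp_all add: zero_fun_def plus_fun_def)

text \<open>After the exchange, the coefficient of \<open>M_qsym \<beta>\<close> is a Moebius sum
  over the compositions above \<tau> and \<beta> and below \<gamma>. They form the interval from the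
  join of \<tau> and \<beta> to \<gamma>, so the sum vanishes unless the join is \<gamma>.\<close>

lemma sum_mobius_F_qsym:
  assumes "\<alpha> \<preceq>\<^sub>P \<gamma>" "composition \<tau>" "sum_list \<tau> = sum_list \<alpha>"
    and \<tau>: "psums \<tau> = {1..sum_list \<alpha>} - (psums \<alpha> - psums \<gamma>)"
  shows "(\<Sum>\<delta> | \<tau> \<preceq>\<^sub>P \<delta> \<and> \<delta> \<preceq>\<^sub>P \<gamma>. of_int (comp_mobius \<delta> \<gamma>) *\<^sub>Q F_qsym \<delta>) =
    (\<Sum>\<beta> | \<alpha> \<preceq>\<^sub>P \<beta> \<and> \<beta> \<preceq>\<^sub>P \<gamma>. M_qsym \<beta>)"
proof
  fix m
  let ?S = "{\<delta>. \<tau> \<preceq>\<^sub>P \<delta> \<and> \<delta> \<preceq>\<^sub>P \<gamma>}" and ?U = "{\<beta>. \<beta> \<preceq>\<^sub>P \<gamma>}"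
  have fin: "finite ?U" by (rule finite_comp_le)
  have finS: "finite ?S" by (rule finite_subset[OF _ fin]) auto
  have \<alpha>: "composition \<alpha>" "composition \<gamma>" "psums \<gamma> \<subseteq> psums \<alpha>" "sum_list \<gamma> = sum_list \<alpha>"
    using assms(1) by (auto simp: comp_le_iff)
  have "psums \<gamma> \<subseteq> psums \<tau>" using psums_subset[OF \<alpha>(2)] \<tau> \<alpha>(4) by auto
  then have \<tau>\<gamma>: "\<tau> \<preceq>\<^sub>P \<gamma>" using assms(2,3) \<alpha> by (simp add: comp_le_iff)
  have inner: "(\<Sum>\<delta>\<in>{\<delta>\<in>?S. \<beta> \<preceq>\<^sub>P \<delta>}. comp_mobius \<delta> \<gamma>) = (if \<alpha> \<preceq>\<^sub>P \<beta> then 1 else 0)"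
    if "\<beta> \<in> ?U" for \<beta>
  proof -
    have \<beta>: "composition \<beta>" "psums \<gamma> \<subseteq> psums \<beta>" "sum_list \<beta> = sum_list \<alpha>"
      using that \<alpha>(4) by (auto simp: comp_le_iff)
    \<comment> \<open>In the reversed order, joins are intersections of prefix-sum sets.\<close>
    have "psums \<tau> \<inter> psums \<beta> \<in> psums ` ?S"
      using bij_betw_imp_surj_on[OF bij_betw_psums_interval[OF \<tau>\<gamma>]] \<open>psums \<gamma> \<subseteq> psums \<tau>\<close> \<beta>(2) by simp
    then obtain \<epsilon> where \<epsilon>: "\<epsilon> \<in> ?S" "psums \<epsilon> = psums \<tau> \<inter> psums \<beta>" by auto
    then have "composition \<epsilon>" "sum_list \<epsilon> = sum_list \<alpha>" using \<alpha>(4) by (auto simp: comp_le_iff)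
    then have "\<tau> \<preceq>\<^sub>P \<delta> \<and> \<beta> \<preceq>\<^sub>P \<delta> \<longleftrightarrow> \<epsilon> \<preceq>\<^sub>P \<delta>" for \<delta>
      using assms(2,3) \<beta>(1,3) unfolding comp_le_iff \<epsilon>(2) by auto
    then have "{\<delta>\<in>?S. \<beta> \<preceq>\<^sub>P \<delta>} = {\<delta>. \<epsilon> \<preceq>\<^sub>P \<delta> \<and> \<delta> \<preceq>\<^sub>P \<gamma>}"
      by blast
    then have "(\<Sum>\<delta>\<in>{\<delta>\<in>?S. \<beta> \<preceq>\<^sub>P \<delta>}. comp_mobius \<delta> \<gamma>)
        = (\<Sum>\<delta> | \<epsilon> \<preceq>\<^sub>P \<delta> \<and> \<delta> \<preceq>\<^sub>P \<gamma>. (-1) ^ length \<delta>) * (-1) ^ length \<gamma>"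
      by (simp add: comp_mobius_eq power_add sum_distrib_right)
    also have "\<dots> = (if \<epsilon> = \<gamma> then 1 else 0)"
      using \<epsilon>(1) by (subst sum_alternating_comp_interval) (auto simp: power_add[symmetric])
    also have "\<epsilon> = \<gamma> \<longleftrightarrow> psums \<tau> \<inter> psums \<beta> = psums \<gamma>"
      using \<epsilon> psums_inject[of \<epsilon> \<gamma>] by (auto simp: comp_le_iff)
    \<comment> \<open>\<tau> omits precisely the prefix sums that \<alpha> has beyond \<gamma>, so
      the intersection shrinks to those of \<gamma> when \<beta> adds only omitted ones.\<close>
    also have "\<dots> \<longleftrightarrow> psums \<beta> \<subseteq> psums \<alpha>"
      unfolding \<tau> using \<alpha>(3) \<beta>(2) psums_subset[OF \<beta>(1)] \<beta>(3) by auto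
    also have "\<dots> \<longleftrightarrow> \<alpha> \<preceq>\<^sub>P \<beta>" using \<beta> \<alpha> by (auto simp: comp_le_iff)
    finally show ?thesis .
  qed
  have F: "F_qsym \<delta> m = (\<Sum>\<beta>\<in>?U. if \<beta> \<preceq>\<^sub>P \<delta> then M_qsym \<beta> m else 0)" if "\<delta> \<in> ?S" for \<delta>
  proof -
    have "{\<beta>. \<beta> \<preceq>\<^sub>P \<delta>} = {\<beta>\<in>?U. \<beta> \<preceq>\<^sub>P \<delta>}" using that comp_le_trans by blast
    then have "F_qsym \<delta> m = (\<Sum>\<beta>\<in>{\<beta>\<in>?U. \<beta> \<preceq>\<^sub>P \<delta>}. M_qsym \<beta> m)"
      by (simp only: F_qsym_def sum_apply)
    then show ?thesis by (simp only: sum.inter_filter[OF fin])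
  qed
  have "(\<Sum>\<delta>\<in>?S. of_int (comp_mobius \<delta> \<gamma>) *\<^sub>Q F_qsym \<delta>) m
      = (\<Sum>\<delta>\<in>?S. \<Sum>\<beta>\<in>?U. if \<beta> \<preceq>\<^sub>P \<delta> then of_int (comp_mobius \<delta> \<gamma>) * M_qsym \<beta> m else 0)"
    unfolding sum_apply by (intro sum.cong refl) (simp add: ps_scale_def F sum_distrib_left if_distrib cong: if_cong)
  also have "\<dots> = (\<Sum>\<beta>\<in>?U. \<Sum>\<delta>\<in>?S. if \<beta> \<preceq>\<^sub>P \<delta> then of_int (comp_mobius \<delta> \<gamma>) * M_qsym \<beta> m else 0)"
    by (rule sum.swap)
  also have "\<dots> = (\<Sum>\<beta>\<in>?U. of_int (\<Sum>\<delta>\<in>{\<delta>\<in>?S. \<beta> \<preceq>\<^sub>P \<delta>}. comp_mobius \<delta> \<gamma>) * M_qsym \<beta> m)"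
    using finS by (simp only: sum.inter_filter[symmetric] of_int_sum sum_distrib_right)
  also have "\<dots> = (\<Sum>\<beta>\<in>?U. if \<alpha> \<preceq>\<^sub>P \<beta> then M_qsym \<beta> m else 0)"
    using inner by (intro sum.cong refl) simp
  also have "\<dots> = (\<Sum>\<beta>\<in>{\<beta>\<in>?U. \<alpha> \<preceq>\<^sub>P \<beta>}. M_qsym \<beta> m)"
    using fin by (simp only: sum.inter_filter)
  also have "{\<beta>\<in>?U. \<alpha> \<preceq>\<^sub>P \<beta>} = {\<beta>. \<alpha> \<preceq>\<^sub>P \<beta> \<and> \<beta> \<preceq>\<^sub>P \<gamma>}" by auto
  finally show "(\<Sum>\<delta>\<in>?S. of_int (comp_mobius \<delta> \<gamma>) *\<^sub>Q F_qsym \<delta>) m = (\<Sum>\<beta> | \<alpha> \<preceq>\<^sub>P \<beta> \<and> \<beta> \<preceq>\<^sub>P \<gamma>. M_qsym \<beta>) m"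
    by (simp add: sum_apply)
qed


section \<open>Counting block permutations\<close>

text \<open>Places beyond the last piece receive \<open>length \<gamma>s\<close>, so the function is
  monotone on all natural numbers.\<close>

fun piece_index :: "'a list list \<Rightarrow> nat \<Rightarrow> nat" where
  "piece_index [] i = 0"
| "piece_index (\<gamma> # \<gamma>s) i = (if i < length \<gamma> then 0 else Suc (piece_index \<gamma>s (i - length \<gamma>)))"

lemma piece_index_mono: "i \<le> j \<Longrightarrow> piece_index \<gamma>s i \<le> piece_index \<gamma>s j"
  by (induction \<gamma>s arbitrary: i j) (auto simp: diff_le_mono)

lemma piece_index_less: "i < length (concat \<gamma>s) \<Longrightarrow> piece_index \<gamma>s i < length \<gamma>s"
  by (induction \<gamma>s arbitrary: i) auto

lemma card_nth_append:
  "card {i. i < length (xs @ ys) \<and> P i} =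
    card {i. i < length xs \<and> P i} + card {i. i < length ys \<and> P (length xs + i)}"
proof -
  let ?A = "{i. i < length xs \<and> P i}" and ?B = "{i. i < length ys \<and> P (length xs + i)}"
  have "{i. i < length (xs @ ys) \<and> P i} = ?A \<union> (+) (length xs) ` ?B"
    by (auto simp: image_iff) (metis add_diff_inverse_nat nat_add_left_cancel_less)
  moreover have "card (?A \<union> (+) (length xs) ` ?B) = card ?A + card ((+) (length xs) ` ?B)"
    by (rule card_Un_disjoint) auto
  moreover have "card ((+) (length xs) ` ?B) = card ?B"
    by (rule card_image) simp
  ultimately show ?thesis by (simp only:)
qed

lemma count_list_eq_card: "count_list xs x = card {i. i < length xs \<and> xs ! i = x}"
proof -
  have "(=) x = (\<lambda>y. y = x)" by auto
  then show ?thesis by (simp only: count_list_eq_length_filter length_filter_conv_card)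
qed

text \<open>The fibre sizes of the colouring by part and piece are the multiplicities whose
  factorials form the denominator of \<open>coeff_C\<close>.\<close>

lemma count_list_piece:
  assumes "j < length \<gamma>s"
  shows "card {i. i < length (concat \<gamma>s) \<and> piece_index \<gamma>s i = j \<and> concat \<gamma>s ! i = x} = count_list (\<gamma>s ! j) x"
  using assms
proof (induction \<gamma>s arbitrary: j)
  case (Cons \<gamma> \<gamma>s)
  have first: "{i. i < length \<gamma> \<and> piece_index (\<gamma> # \<gamma>s) i = j \<and> (\<gamma> @ concat \<gamma>s) ! i = x} =
      (if j = 0 then {i. i < length \<gamma> \<and> \<gamma> ! i = x} else {})"
    by (auto simp: nth_append)
  have rest: "{i. i < length (concat \<gamma>s) \<and> piece_index (\<gamma> # \<gamma>s) (length \<gamma> + i) = j \<and> (\<gamma> @ concat \<gamma>s) ! (length \<gamma> + i) = x} =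
      (if j = 0 then {} else {i. i < length (concat \<gamma>s) \<and> piece_index \<gamma>s i = j - 1 \<and> concat \<gamma>s ! i = x})"
    by auto
  have split: "card {i. i < length (concat (\<gamma> # \<gamma>s)) \<and> piece_index (\<gamma> # \<gamma>s) i = j \<and> concat (\<gamma> # \<gamma>s) ! i = x} =
      card (if j = 0 then {i. i < length \<gamma> \<and> \<gamma> ! i = x} else {}) +
      card (if j = 0 then {} else {i. i < length (concat \<gamma>s) \<and> piece_index \<gamma>s i = j - 1 \<and> concat \<gamma>s ! i = x})"
    unfolding first[symmetric] rest[symmetric] concat.simps by (rule card_nth_append)
  show ?case
  proof (cases j)
    case 0
    then show ?thesis unfolding split by (simp add: count_list_eq_card)
  next
    case (Suc j')
    then have "j' < length \<gamma>s" using Cons.prems by simp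
    from Cons.IH[OF this] show ?thesis unfolding split by (simp add: Suc)
  qed
qed simp

lemma piece_index_Suc_eq_iff:
  assumes "[] \<notin> set \<gamma>s" "composition (concat \<gamma>s)" "Suc i < length (concat \<gamma>s)"
  shows "piece_index \<gamma>s i = piece_index \<gamma>s (Suc i) \<longleftrightarrow>
    sum_list (take (Suc i) (concat \<gamma>s)) \<notin> psums (map sum_list \<gamma>s)"
  using assms
proof (induction \<gamma>s arbitrary: i)
  case (Cons \<gamma> \<gamma>s)
  let ?g = "sum_list \<gamma>" and ?B = "psums (map sum_list \<gamma>s)"
  have comp: "composition \<gamma>" "composition (concat \<gamma>s)"
    using Cons.prems by (simp_all add: composition_append)
  \<comment> \<open>Inside the first piece the prefix sum stays below \<open>?g\<close>, at its end
    it equals \<open>?g\<close>, and further on the piece is stripped off for the induction.\<close>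
  consider "Suc i < length \<gamma>" | "Suc i = length \<gamma>" | "length \<gamma> \<le> i" by linarith
  then show ?case
  proof cases
    case 1
    then have "sum_list (take (Suc i) \<gamma>) \<in> comp_set \<gamma>" by (auto simp: comp_set_def)
    then have "sum_list (take (Suc i) \<gamma>) < ?g"
      using psums_subset[OF comp(1)] by (fastforce simp: comp_set_eq_psums[OF comp(1)])
    then show ?thesis using 1 by (auto simp: psums_Cons)
  next
    case 2
    then show ?thesis by (auto simp: psums_Cons)
  next
    case 3
    define i' where "i' = i - length \<gamma>"
    have i: "i = length \<gamma> + i'" using 3 by (simp add: i'_def)
    have i': "Suc i' < length (concat \<gamma>s)" using Cons.prems by (simp add: i)
    have "sum_list (take (Suc i') (concat \<gamma>s)) \<in> psums (concat \<gamma>s)"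
      using i' unfolding psums_def by auto
    then have "sum_list (take (Suc i') (concat \<gamma>s)) > 0" using psums_subset[OF comp(2)] by fastforce
    then show ?thesis using Cons.IH[OF _ comp(2) i'] Cons.prems
      by (auto simp: i psums_Cons simp del: sum_list_eq_0_iff)
  qed
qed simp

section \<open>The orders of the two Young subgroups and their quotient\<close>

lemma card_class_perms_nth:
  "card (class_perms {..<length \<alpha>} ((!) \<alpha>)) = (\<Prod>x\<in>set \<alpha>. fact (count_list \<alpha> x))"
proof -
  have "(!) \<alpha> ` {..<length \<alpha>} = set \<alpha>" by (auto simp: in_set_conv_nth)
  then show ?thesis by (simp add: card_class_perms count_list_eq_card)
qed

lemma card_class_perms_pieces:
  "card (class_perms {..<length (concat \<gamma>s)} (\<lambda>i. (concat \<gamma>s ! i, piece_index \<gamma>s i))) =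
    (\<Prod>x\<in>set (concat \<gamma>s). \<Prod>\<gamma>\<leftarrow>\<gamma>s. fact (count_list \<gamma> x))"
proof -
  let ?\<alpha> = "concat \<gamma>s"
  let ?P = "{..<length ?\<alpha>}" and ?d = "\<lambda>i. (?\<alpha> ! i, piece_index \<gamma>s i)"
  have count: "card {i \<in> ?P. ?d i = (x, j)} = count_list (\<gamma>s ! j) x" if "j < length \<gamma>s" for x j
    using count_list_piece[OF that, of x] by (simp add: conj_commute)
  have "card (class_perms ?P ?d) = (\<Prod>y\<in>?d ` ?P. fact (card {i \<in> ?P. ?d i = y}))"
    by (rule card_class_perms) simp
  \<comment> \<open>Pairs of a part and a piece that do not occur have empty fibres and contribute
    0! = 1; the full rectangle then splits into a double product.\<close>
  also have "\<dots> = (\<Prod>y\<in>set ?\<alpha> \<times> {..<length \<gamma>s}. fact (card {i \<in> ?P. ?d i = y}))"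
  proof (rule prod.mono_neutral_left)
    show "\<forall>y\<in>set ?\<alpha> \<times> {..<length \<gamma>s} - ?d ` ?P. fact (card {i \<in> ?P. ?d i = y}) = (1 :: nat)"
    proof
      fix y assume "y \<in> set ?\<alpha> \<times> {..<length \<gamma>s} - ?d ` ?P"
      then have "{i \<in> ?P. ?d i = y} = {}" by blast
      then show "fact (card {i \<in> ?P. ?d i = y}) = (1 :: nat)" by (simp only: card.empty fact_0)
    qed
    show "?d ` ?P \<subseteq> set ?\<alpha> \<times> {..<length \<gamma>s}"
      using nth_mem[of _ ?\<alpha>] piece_index_less[of _ \<gamma>s] by blast
  qed simp
  also have "\<dots> = (\<Prod>y\<in>set ?\<alpha> \<times> {..<length \<gamma>s}. fact (count_list (\<gamma>s ! snd y) (fst y)))"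
    using count by (intro prod.cong refl) force
  also have "\<dots> = (\<Prod>x\<in>set ?\<alpha>. \<Prod>j<length \<gamma>s. fact (count_list (\<gamma>s ! j) x))"
    by (simp add: prod.cartesian_product case_prod_beta)
  also have "\<dots> = (\<Prod>x\<in>set ?\<alpha>. \<Prod>\<gamma>\<leftarrow>\<gamma>s. fact (count_list \<gamma> x))"
    by (simp add: prod.list_conv_set_nth lessThan_atLeast0)
  finally show ?thesis .
qed

text \<open>The coefficient is an index of Young subgroups, written without division to match
  \<open>card_sorted_class_perms\<close>.\<close>

lemma coeff_C_eq:
  assumes "composition \<alpha>" "grouping \<alpha> \<beta> \<gamma>s"
  shows "coeff_C \<alpha> \<beta> * rat_of_nat (\<Prod>x\<in>set \<alpha>. \<Prod>\<gamma>\<leftarrow>\<gamma>s. fact (count_list \<gamma> x)) =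
    rat_of_nat (\<Prod>x\<in>set \<alpha>. fact (count_list \<alpha> x))"
proof -
  have cast: "rat_of_nat (\<Prod>\<gamma>\<leftarrow>\<gamma>s. fact (count_list \<gamma> x)) = (\<Prod>\<gamma>\<leftarrow>\<gamma>s. fact (count_list \<gamma> x))" for x
    by (induction \<gamma>s) simp_all
  have nz: "(\<Prod>\<gamma>\<leftarrow>\<gamma>s. fact (count_list \<gamma> x) :: rat) \<noteq> 0" for x
    by (induction \<gamma>s) simp_all
  show ?thesis
    unfolding coeff_C_def pieces_eq[OF assms] of_nat_prod cast prod.distrib[symmetric]
    by (intro prod.cong refl) (simp add: nz)
qed

text \<open>The rank counts predecessors. It makes an abstract order numerical, as the maximisation
  behind the sorted representatives requires.\<close>

lemma ex_rank_function:
  assumes "finite P" "inj_on f P" "strict_total_order_on (f ` P) R"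
  shows "\<exists>v :: 'a \<Rightarrow> nat. inj_on v P \<and> (\<forall>i\<in>P. \<forall>j\<in>P. v i < v j \<longleftrightarrow> R (f i) (f j))"
proof -
  define v where "v i = card {l \<in> P. R (f l) (f i)}" for i
  have irrefl: "\<not> R (f i) (f i)" if "i \<in> P" for i
    using assms(3) that unfolding strict_total_order_on_def irreflp_on_def by blast
  have trans: "R (f i) (f l)" if "i \<in> P" "j \<in> P" "l \<in> P" "R (f i) (f j)" "R (f j) (f l)" for i j l
    using assms(3) that unfolding strict_total_order_on_def transp_on_def by (meson imageI)
  have less: "v i < v j" if "i \<in> P" "j \<in> P" "R (f i) (f j)" for i j
  proof -
    have "{l \<in> P. R (f l) (f i)} \<subseteq> {l \<in> P. R (f l) (f j)}"
      using trans[OF _ that(1,2) _ that(3)] by auto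
    moreover have "i \<in> {l \<in> P. R (f l) (f j)} - {l \<in> P. R (f l) (f i)}" using that irrefl by simp
    ultimately show ?thesis unfolding v_def using assms(1) by (intro psubset_card_mono) auto
  qed
  have tot: "R (f i) (f j) \<or> R (f j) (f i)" if "i \<in> P" "j \<in> P" "i \<noteq> j" for i j
    using strict_total_order_on_flip[OF assms(3), of "f i" "f j"] that assms(2) by (auto simp: inj_on_def)
  have "v i < v j \<longleftrightarrow> R (f i) (f j)" if "i \<in> P" "j \<in> P" for i j
    using less[of i j] less[of j i] tot[of i j] that
    by (cases "i = j") (auto simp: irrefl)
  moreover have "inj_on v P"
    using less tot by (intro inj_onI) (metis less_irrefl)
  ultimately show ?thesis by blast
qed

text \<open>Here \<open>a\<close>, \<open>q\<close> and \<open>r\<close> stand for sizes, pieces and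
  the order \<rhd> of the permuted blocks. Neighbouring comparisons chain within a piece, since
  monotone \<open>q\<close> is constant between two places of the same piece. Conversely, neighbours
  in a piece have equal sizes or are ordered by \<open>unequal\<close>.\<close>

lemma sorted_pieces_iff:
  fixes a :: "nat \<Rightarrow> nat" and q :: "nat \<Rightarrow> nat"
  assumes q: "\<And>i j. i \<le> j \<Longrightarrow> q i \<le> q j"
    and flip: "\<And>i j. i < k \<Longrightarrow> j < k \<Longrightarrow> i \<noteq> j \<Longrightarrow> \<not> r i j \<longleftrightarrow> r j i"
    and trans: "\<And>i j l. i < k \<Longrightarrow> j < k \<Longrightarrow> l < k \<Longrightarrow> r i j \<Longrightarrow> r j l \<Longrightarrow> r i l"
    and unequal: "\<And>i. Suc i < k \<Longrightarrow> q i = q (Suc i) \<Longrightarrow> a i \<noteq> a (Suc i) \<Longrightarrow> r i (Suc i)"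
  shows "(\<forall>i. Suc i < k \<longrightarrow> r (Suc i) i \<longrightarrow> q i \<noteq> q (Suc i)) \<longleftrightarrow>
    (\<forall>i<k. \<forall>j<k. i < j \<longrightarrow> (a i, q i) = (a j, q j) \<longrightarrow> r i j)" (is "?L \<longleftrightarrow> ?R")
proof
  assume L: ?L
  have "r i j" if "i < j" "j < k" "q i = q j" for i j
    using that
  proof (induction j)
    case (Suc j)
    have "q i \<le> q j" "q j \<le> q (Suc j)" using Suc.prems(1) by (simp_all add: q)
    then have eq: "q i = q j" "q j = q (Suc j)" using Suc.prems(3) by simp_all
    have "\<not> r (Suc j) j" using L Suc.prems eq by blast
    then have step: "r j (Suc j)" using flip[of j "Suc j"] Suc.prems by simp
    show ?case
    proof (cases "i = j")
      case False
      then have "r i j" using Suc eq by auto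
      then show ?thesis using trans[of i j "Suc j"] step Suc.prems by simp
    qed (use step in simp)
  qed simp
  then show ?R by simp
next
  assume R: ?R
  show ?L
  proof (intro allI impI notI)
    fix i assume i: "Suc i < k" "r (Suc i) i" "q i = q (Suc i)"
    have "r i (Suc i)" using R[rule_format, of i "Suc i"] unequal[of i] i by (cases "a i = a (Suc i)") auto
    then show False using flip[of i "Suc i"] i by simp
  qed
qed

lemma block_perms_eq: "block_perms \<Phi> = class_perms {..<length (block_sizes \<Phi>)} ((!) (block_sizes \<Phi>))"
proof -
  have "card (\<Phi> ! \<sigma> i) = card (\<Phi> ! i) \<longleftrightarrow> block_sizes \<Phi> ! \<sigma> i = block_sizes \<Phi> ! i"
    if "\<sigma> permutes {..<length \<Phi>}" "i < length \<Phi>" for \<sigma> i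
    using that permutes_in_image[OF that(1), of i] by (simp add: block_sizes_def)
  then show ?thesis by (auto simp: block_perms_def class_perms_def)
qed

lemma block_perms_permute:
  assumes "\<sigma> \<in> block_perms \<Phi>"
  shows "block_sizes (permute_list \<sigma> \<Phi>) = block_sizes \<Phi>"
    "mset (permute_list \<sigma> \<Phi>) = mset \<Phi>"
    "i < length \<Phi> \<Longrightarrow> permute_list \<sigma> \<Phi> ! i = \<Phi> ! \<sigma> i"
    "i < length \<Phi> \<Longrightarrow> \<sigma> i < length \<Phi>"
proof -
  have \<sigma>: "\<sigma> permutes {..<length \<Phi>}" using assms by (simp add: block_perms_def)
  show "mset (permute_list \<sigma> \<Phi>) = mset \<Phi>" using \<sigma> by simp
  show "i < length \<Phi> \<Longrightarrow> permute_list \<sigma> \<Phi> ! i = \<Phi> ! \<sigma> i" for i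
    using \<sigma> by (simp add: permute_list_nth)
  then show "block_sizes (permute_list \<sigma> \<Phi>) = block_sizes \<Phi>"
    using assms by (intro nth_equalityI) (auto simp: block_sizes_def block_perms_def)
  show "i < length \<Phi> \<Longrightarrow> \<sigma> i < length \<Phi>" using permutes_in_image[OF \<sigma>, of i] by simp
qed

text \<open>This is the coefficient of \<open>M_qsym \<beta>\<close> in the sum over all \<sigma>.
  The size at each place is the same for every \<sigma>, so \<prec> orders neighbours of different
  sizes uniformly in \<sigma>.\<close>

lemma card_block_perms_le_rho_C:
  assumes blocks: "set \<Phi> \<subseteq> blocks" "disjoint (set \<Phi>)" "distinct \<Phi>"
    and ord: "strict_total_order_on (set \<Phi>) tri" and prec: "strict_total_order_on {1..} prec"
    and proj: "projects_to tri prec" and le: "block_sizes \<Phi> \<preceq>\<^sub>P \<beta>"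
  shows "rat_of_nat (card {\<sigma> \<in> block_perms \<Phi>. \<beta> \<preceq>\<^sub>P rho_C tri (permute_list \<sigma> \<Phi>)}) =
    (if \<beta> \<preceq>\<^sub>P comp_C prec (block_sizes \<Phi>) then coeff_C (block_sizes \<Phi>) \<beta> else 0)"
proof -
  let ?\<alpha> = "block_sizes \<Phi>" and ?k = "length \<Phi>"
  let ?cut = "\<lambda>i. sum_list (take (Suc i) ?\<alpha>) \<in> psums \<beta>"
  have comp: "composition ?\<alpha>" using le by (simp add: comp_le_iff)
  have mem: "\<Phi> ! i \<in> set \<Phi>" "\<Phi> ! i \<in> blocks" "?\<alpha> ! i = card (\<Phi> ! i)" "1 \<le> ?\<alpha> ! i" if "i < ?k" for i
  proof -
    show "\<Phi> ! i \<in> set \<Phi>" "?\<alpha> ! i = card (\<Phi> ! i)" using that by (simp_all add: block_sizes_def)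
    then show "\<Phi> ! i \<in> blocks" using blocks(1) by blast
    then show "1 \<le> ?\<alpha> ! i" using \<open>?\<alpha> ! i = card (\<Phi> ! i)\<close> by (auto simp: blocks_def Suc_le_eq card_gt_0_iff)
  qed
  have flip: "\<not> tri (\<Phi> ! i) (\<Phi> ! j) \<longleftrightarrow> tri (\<Phi> ! j) (\<Phi> ! i)" if "i < ?k" "j < ?k" "i \<noteq> j" for i j
    using that mem blocks(3) by (intro strict_total_order_on_flip[OF ord]) (auto simp: nth_eq_iff_index_eq)
  have trans: "tri (\<Phi> ! i) (\<Phi> ! l)"
    if "i < ?k" "j < ?k" "l < ?k" "tri (\<Phi> ! i) (\<Phi> ! j)" "tri (\<Phi> ! j) (\<Phi> ! l)" for i j l
    using ord mem that unfolding strict_total_order_on_def transp_on_def by meson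
  have prec_flip: "\<not> prec x y \<longleftrightarrow> prec y x" if "1 \<le> x" "1 \<le> y" "x \<noteq> y" for x y
    using that by (intro strict_total_order_on_flip[OF prec]) auto
  have prec_irrefl: "\<not> prec x x" if "1 \<le> x" for x
    using prec that unfolding strict_total_order_on_def irreflp_on_def by simp
  have project: "prec (?\<alpha> ! j) (?\<alpha> ! i)"
    if "i < ?k" "j < ?k" "?\<alpha> ! i \<noteq> ?\<alpha> ! j" "tri (\<Phi> ! i) (\<Phi> ! j)" for i j
  proof -
    have "\<Phi> ! i \<inter> \<Phi> ! j = {}"
      using that mem blocks(2) by (intro disjointD[OF blocks(2)]) auto
    then show ?thesis
      using proj that mem unfolding projects_to_def by (metis inf_commute)
  qed
  have rho_C: "\<beta> \<preceq>\<^sub>P rho_C tri (permute_list \<sigma> \<Phi>) \<longleftrightarrow>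
      (\<forall>i. Suc i < ?k \<longrightarrow> tri (\<Phi> ! \<sigma> (Suc i)) (\<Phi> ! \<sigma> i) \<longrightarrow> ?cut i)"
    if "\<sigma> \<in> block_perms \<Phi>" for \<sigma>
    using block_perms_permute[OF that] le by (subst comp_le_rho_C_iff) auto
  have size: "?\<alpha> ! \<sigma> i = ?\<alpha> ! i" if "\<sigma> \<in> block_perms \<Phi>" "i < ?k" for \<sigma> i
    using that by (simp add: block_perms_eq class_perms_def)
  show ?thesis
  proof (cases "\<beta> \<preceq>\<^sub>P comp_C prec ?\<alpha>")
    case True
    obtain \<gamma>s where \<gamma>s: "grouping ?\<alpha> \<beta> \<gamma>s" using le by (auto simp: comp_le_def)
    then have conc: "concat \<gamma>s = ?\<alpha>" by (simp add: grouping_def)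
    let ?q = "piece_index \<gamma>s" and ?P = "{..<?k}"
    have cut: "?q i = ?q (Suc i) \<longleftrightarrow> \<not> ?cut i" if "Suc i < ?k" for i
      using piece_index_Suc_eq_iff[of \<gamma>s i] that \<gamma>s comp by (auto simp: grouping_def)
    have "(!) \<Phi> ` ?P = set \<Phi>" by (auto simp: in_set_conv_nth)
    then have ord': "strict_total_order_on ((!) \<Phi> ` ?P) tri" using ord by simp
    have inj_nth: "inj_on ((!) \<Phi>) ?P" using blocks(3) by (simp add: inj_on_nth)
    \<comment> \<open>The rank grows as blocks descend for \<rhd>, so increasing ranks mean
      decreasing blocks.\<close>
    obtain v :: "nat \<Rightarrow> nat" where v: "inj_on v ?P"
      "\<forall>i\<in>?P. \<forall>j\<in>?P. v i < v j \<longleftrightarrow> tri (\<Phi> ! i) (\<Phi> ! j)"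
      using ex_rank_function[OF finite_lessThan inj_nth ord'] by auto
    have "\<beta> \<preceq>\<^sub>P rho_C tri (permute_list \<sigma> \<Phi>) \<longleftrightarrow>
        (\<forall>i\<in>?P. \<forall>j\<in>?P. i < j \<longrightarrow> (?\<alpha> ! i, ?q i) = (?\<alpha> ! j, ?q j) \<longrightarrow> v (\<sigma> i) < v (\<sigma> j))"
      if \<sigma>: "\<sigma> \<in> block_perms \<Phi>" for \<sigma>
    proof -
      note in_range = block_perms_permute(4)[OF \<sigma>]
      have inj: "\<sigma> i \<noteq> \<sigma> j" if "i \<noteq> j" for i j
        using \<sigma> that permutes_inj by (fastforce simp: block_perms_def dest: injD)
      let ?r = "\<lambda>i j. tri (\<Phi> ! \<sigma> i) (\<Phi> ! \<sigma> j)"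
      \<comment> \<open>Were the neighbours in the other order, projection would make the sizes
        ascend for \<prec>, and \<beta>, lying below \<open>comp_C\<close>, would cut between
        them.\<close>
      have unequal: "?r i (Suc i)" if i: "Suc i < ?k" "?q i = ?q (Suc i)" "?\<alpha> ! i \<noteq> ?\<alpha> ! Suc i" for i
      proof (rule ccontr)
        assume "\<not> ?r i (Suc i)"
        then have "?r (Suc i) i" using flip[of "\<sigma> i" "\<sigma> (Suc i)"] in_range inj[of i "Suc i"] i by simp
        then have "prec (?\<alpha> ! i) (?\<alpha> ! Suc i)"
          using project[of "\<sigma> (Suc i)" "\<sigma> i"] in_range size[OF \<sigma>] i by simp
        then have "?cut i" using True comp_le_comp_C_iff[OF le] i by simp
        then show False using cut i by simp
      qed
      have rank: "v (\<sigma> i) < v (\<sigma> j) \<longleftrightarrow> ?r i j" if "i < ?k" "j < ?k" for i j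
        using v(2) in_range[OF that(1)] in_range[OF that(2)] by blast
      have "\<beta> \<preceq>\<^sub>P rho_C tri (permute_list \<sigma> \<Phi>) \<longleftrightarrow>
          (\<forall>i. Suc i < ?k \<longrightarrow> ?r (Suc i) i \<longrightarrow> ?q i \<noteq> ?q (Suc i))"
        using rho_C[OF \<sigma>] cut by blast
      also have "\<dots> \<longleftrightarrow> (\<forall>i<?k. \<forall>j<?k. i < j \<longrightarrow> (?\<alpha> ! i, ?q i) = (?\<alpha> ! j, ?q j) \<longrightarrow> ?r i j)"
      proof (rule sorted_pieces_iff)
        show "\<not> ?r i j \<longleftrightarrow> ?r j i" if "i < ?k" "j < ?k" "i \<noteq> j" for i j
          using flip[OF in_range in_range inj] that by simp
        show "?r i l" if "i < ?k" "j < ?k" "l < ?k" "?r i j" "?r j l" for i j l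
          using trans[OF in_range in_range in_range that(4,5)] that by simp
      qed (use unequal piece_index_mono in auto)
      also have "\<dots> \<longleftrightarrow> (\<forall>i\<in>?P. \<forall>j\<in>?P. i < j \<longrightarrow> (?\<alpha> ! i, ?q i) = (?\<alpha> ! j, ?q j) \<longrightarrow> v (\<sigma> i) < v (\<sigma> j))"
        by (simp add: Ball_def rank cong: imp_cong)
      finally show ?thesis .
    qed
    then have "{\<sigma> \<in> block_perms \<Phi>. \<beta> \<preceq>\<^sub>P rho_C tri (permute_list \<sigma> \<Phi>)} =
        sorted_class_perms ?P ((!) ?\<alpha>) (\<lambda>i. (?\<alpha> ! i, ?q i)) v"
      unfolding sorted_class_perms_def using block_perms_eq[of \<Phi>] by auto
    moreover have "card (sorted_class_perms ?P ((!) ?\<alpha>) (\<lambda>i. (?\<alpha> ! i, ?q i)) v) *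
        card (class_perms ?P (\<lambda>i. (?\<alpha> ! i, ?q i))) = card (class_perms ?P ((!) ?\<alpha>))"
      by (rule card_sorted_class_perms[OF _ v(1)]) auto
    moreover have "card (class_perms ?P (\<lambda>i. (?\<alpha> ! i, ?q i))) = (\<Prod>x\<in>set ?\<alpha>. \<Prod>\<gamma>\<leftarrow>\<gamma>s. fact (count_list \<gamma> x))"
      using card_class_perms_pieces[of \<gamma>s] by (simp add: conc)
    moreover have "card (class_perms ?P ((!) ?\<alpha>)) = (\<Prod>x\<in>set ?\<alpha>. fact (count_list ?\<alpha> x))"
      using card_class_perms_nth[of ?\<alpha>] by simp
    \<comment> \<open>Both sides equal the order of \<open>block_perms \<Phi>\<close>; the order of
      the piece-preserving subgroup is then cancelled.\<close>
    ultimately have "rat_of_nat (card {\<sigma> \<in> block_perms \<Phi>. \<beta> \<preceq>\<^sub>P rho_C tri (permute_list \<sigma> \<Phi>)}) *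
        rat_of_nat (\<Prod>x\<in>set ?\<alpha>. \<Prod>\<gamma>\<leftarrow>\<gamma>s. fact (count_list \<gamma> x)) =
        coeff_C ?\<alpha> \<beta> * rat_of_nat (\<Prod>x\<in>set ?\<alpha>. \<Prod>\<gamma>\<leftarrow>\<gamma>s. fact (count_list \<gamma> x))"
      unfolding coeff_C_eq[OF comp \<gamma>s] of_nat_mult[symmetric] by (simp only:)
    moreover have "(\<Prod>x\<in>set ?\<alpha>. \<Prod>\<gamma>\<leftarrow>\<gamma>s. fact (count_list \<gamma> x)) \<noteq> (0 :: nat)"
      by (auto simp: prod_list_zero_iff)
    ultimately show ?thesis using True by (simp only: mult_cancel_right of_nat_eq_0_iff simp_thms if_True)
  next
    case False
    then obtain i where i: "Suc i < ?k" "prec (?\<alpha> ! i) (?\<alpha> ! Suc i)" "\<not> ?cut i"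
      using comp_le_comp_C_iff[OF le] by auto
    \<comment> \<open>At the uncut ascent \<open>i\<close> of the sizes, projection forces the
      blocks to ascend for \<rhd> under every \<sigma>, so \<open>rho_C\<close> always has a cut
      that \<beta> lacks.\<close>
    have "\<not> \<beta> \<preceq>\<^sub>P rho_C tri (permute_list \<sigma> \<Phi>)" if \<sigma>: "\<sigma> \<in> block_perms \<Phi>" for \<sigma>
    proof -
      have neq: "?\<alpha> ! i \<noteq> ?\<alpha> ! Suc i" using i prec_irrefl[of "?\<alpha> ! i"] mem[of i] by auto
      note in_range = block_perms_permute(4)[OF \<sigma>]
      have neq': "\<sigma> i \<noteq> \<sigma> (Suc i)" using size[OF \<sigma>] neq i by (metis Suc_lessD)
      have "\<not> tri (\<Phi> ! \<sigma> i) (\<Phi> ! \<sigma> (Suc i))"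
        using project[of "\<sigma> i" "\<sigma> (Suc i)"] prec_flip[of "?\<alpha> ! i" "?\<alpha> ! Suc i"]
          in_range size[OF \<sigma>] neq i mem by auto
      then have "tri (\<Phi> ! \<sigma> (Suc i)) (\<Phi> ! \<sigma> i)"
        using flip[of "\<sigma> i" "\<sigma> (Suc i)"] in_range neq' i by simp
      then show ?thesis using rho_C[OF \<sigma>] i by blast
    qed
    then have "{\<sigma> \<in> block_perms \<Phi>. \<beta> \<preceq>\<^sub>P rho_C tri (permute_list \<sigma> \<Phi>)} = {}" by blast
    then show ?thesis using False by (simp only: card.empty of_nat_0 if_False)
  qed
qed

theorem theorem13:
  fixes tri :: "nat set \<Rightarrow> nat set \<Rightarrow> bool"
    and prec :: "nat \<Rightarrow> nat \<Rightarrow> bool"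
    and n :: nat
    and \<Phi> :: "nat set list"
  assumes "total_order_on_disjoint_sets tri"
    and "strict_total_order_on {1..} prec"
    and "projects_to tri prec"
    and "set_composition n \<Phi>"
  shows "P_qsym prec (block_sizes \<Phi>) =
           (\<Sum>\<sigma>\<in>block_perms \<Phi>. rho (P_nc tri (permute_list \<sigma> \<Phi>))) \<and>
         rho (P_nc tri \<Phi>) =
           (\<Sum>\<alpha> | rho_T tri \<Phi> \<preceq>\<^sub>P \<alpha> \<and> \<alpha> \<preceq>\<^sub>P rho_C tri \<Phi>.
              of_int (comp_mobius \<alpha> (rho_C tri \<Phi>)) *\<^sub>Q F_qsym \<alpha>)"
proof
  let ?\<alpha> = "block_sizes \<Phi>"
  have part: "distinct \<Phi>" "partition_on {1..n} (set \<Phi>)" using assms(4) by (auto simp: set_composition_def)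
  have disj: "disjoint (set \<Phi>)" using part(2) by (rule partition_onD2)
  have blocks: "set \<Phi> \<subseteq> blocks"
  proof
    fix B assume "B \<in> set \<Phi>"
    then have "B \<subseteq> {1..n}" "B \<noteq> {}" using partition_onD1[OF part(2)] partition_onD3[OF part(2)] by blast+
    then show "B \<in> blocks" using finite_subset[of B "{1..n}"] by (auto simp: blocks_def)
  qed
  then have fin: "\<forall>B\<in>set \<Phi>. finite B \<and> B \<noteq> {}" by (auto simp: blocks_def)
  have ord: "strict_total_order_on (set \<Phi>) tri"
    using assms(1) blocks disj by (simp add: total_order_on_disjoint_sets_def)
  \<comment> \<open>Stated for every rearrangement of \<Phi>: part (ii) uses \<Phi> itself, part (i)
    its images under \<open>block_perms\<close>.\<close>
  have rho: "rho (P_nc tri \<Psi>) = (\<Sum>\<beta> | block_sizes \<Psi> \<preceq>\<^sub>P \<beta> \<and> \<beta> \<preceq>\<^sub>P rho_C tri \<Psi>. M_qsym \<beta>)"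
    if "mset \<Psi> = mset \<Phi>" for \<Psi>
  proof (rule rho_P_nc)
    have set: "set \<Psi> = set \<Phi>" and dist: "distinct \<Psi>"
      using that part(1) mset_eq_setD mset_eq_imp_distinct_iff by blast+
    show "distinct \<Psi>" by (rule dist)
    show "\<forall>B\<in>set \<Psi>. finite B \<and> B \<noteq> {}" "strict_total_order_on (set \<Psi>) tri" using set fin ord by simp_all
    have "\<Psi> ! i \<inter> \<Psi> ! j = {}" if "i < j" "j < length \<Psi>" for i j
      using that set dist by (intro disjointD[OF disj]) (auto simp: nth_eq_iff_index_eq simp flip: set)
    then show "sorted_wrt (\<lambda>A B. A \<inter> B = {}) \<Psi>" by (simp add: sorted_wrt_iff_nth_less)
  qed
  show "rho (P_nc tri \<Phi>) = (\<Sum>\<alpha> | rho_T tri \<Phi> \<preceq>\<^sub>P \<alpha> \<and> \<alpha> \<preceq>\<^sub>P rho_C tri \<Phi>.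
      of_int (comp_mobius \<alpha> (rho_C tri \<Phi>)) *\<^sub>Q F_qsym \<alpha>)"
    unfolding rho[OF refl]
    by (rule sum_mobius_F_qsym[OF block_sizes_le_rho_C[OF fin] psums_rho_T[OF fin], symmetric])
  show "P_qsym prec ?\<alpha> = (\<Sum>\<sigma>\<in>block_perms \<Phi>. rho (P_nc tri (permute_list \<sigma> \<Phi>)))"
  proof
    fix m
    \<comment> \<open>The lower bound on \<beta> does not depend on \<sigma>, since
      \<open>block_perms\<close> preserves sizes; the upper bound becomes a condition under the sum,
      so the summations can be exchanged.\<close>
    let ?V = "{\<beta>. ?\<alpha> \<preceq>\<^sub>P \<beta>}"
    have finV: "finite ?V" by (rule finite_comp_ge)
    have finB: "finite (block_perms \<Phi>)" unfolding block_perms_eq by (rule finite_class_perms) simp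
    have "(\<Sum>\<sigma>\<in>block_perms \<Phi>. rho (P_nc tri (permute_list \<sigma> \<Phi>))) m =
        (\<Sum>\<sigma>\<in>block_perms \<Phi>. \<Sum>\<beta>\<in>{\<beta>\<in>?V. \<beta> \<preceq>\<^sub>P rho_C tri (permute_list \<sigma> \<Phi>)}. M_qsym \<beta> m)"
      unfolding sum_apply
      by (intro sum.cong refl) (simp add: rho block_perms_permute sum_apply)
    also have "\<dots> = (\<Sum>\<sigma>\<in>block_perms \<Phi>. \<Sum>\<beta>\<in>?V.
        if \<beta> \<preceq>\<^sub>P rho_C tri (permute_list \<sigma> \<Phi>) then M_qsym \<beta> m else 0)"
      by (simp only: sum.inter_filter[OF finV])
    also have "\<dots> = (\<Sum>\<beta>\<in>?V. \<Sum>\<sigma>\<in>block_perms \<Phi>.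
        if \<beta> \<preceq>\<^sub>P rho_C tri (permute_list \<sigma> \<Phi>) then M_qsym \<beta> m else 0)"
      by (rule sum.swap)
    also have "\<dots> = (\<Sum>\<beta>\<in>?V. rat_of_nat (card {\<sigma>\<in>block_perms \<Phi>. \<beta> \<preceq>\<^sub>P rho_C tri (permute_list \<sigma> \<Phi>)}) * M_qsym \<beta> m)"
      by (simp only: sum.inter_filter[OF finB, symmetric] sum_constant)
    also have "\<dots> = (\<Sum>\<beta>\<in>?V. if \<beta> \<preceq>\<^sub>P comp_C prec ?\<alpha> then coeff_C ?\<alpha> \<beta> * M_qsym \<beta> m else 0)"
      by (intro sum.cong refl)
        (simp add: card_block_perms_le_rho_C[OF blocks disj part(1) ord assms(2,3)])
    also have "\<dots> = (\<Sum>\<beta>\<in>{\<beta>\<in>?V. \<beta> \<preceq>\<^sub>P comp_C prec ?\<alpha>}. coeff_C ?\<alpha> \<beta> * M_qsym \<beta> m)"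
      by (simp only: sum.inter_filter[OF finV])
    also have "\<dots> = P_qsym prec ?\<alpha> m"
      by (simp add: P_qsym_def sum_apply ps_scale_def)
    finally show "P_qsym prec ?\<alpha> m = (\<Sum>\<sigma>\<in>block_perms \<Phi>. rho (P_nc tri (permute_list \<sigma> \<Phi>))) m" ..
  qed
qed

end
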